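(* Let $K$ be an algebraically closed field and let $(\mathcal C,\otimes,I,a,l,r)$ be a monoidal category which is an additive Krull-Schmidt category and whose tensor product $\otimes$ is an additive bifunctor. Then the $K$-Green ring $gr_K(\mathcal C)=K\otimes_{\mathbb Z}gr(\mathcal C)$, regarded as a $K$-linear category with one object, is a $K$-decategorification of $\mathcal C$ (regarded as the one-object additive 2-category $\mathscr C_{\mathcal C}$); equivalently, $\mathcal C$ is a categorification of $gr_K(\mathcal C)$. That is, $K\otimes_{\mathbb Z}[\mathscr C_{\mathcal C}]_\oplus\cong gr_K(\mathcal C)$ as $K$-linear categories.
   Context: Green ring: $gr(\mathcal C)$ is the abelian group generated by the isomorphism classes $[C]$ of objects of $\mathcal C$ modulo the relations $[C]+[D]=[C\oplus D]$, with multiplication $[C][D]=[C\otimes D]$ and identity $[I]$. An additive 2-category is a category enriched over the category of additive categories. The split Grothendieck category $[\mathscr C]_\oplus$ of an additive 2-category $\mathscr C$ has the same objects as $\mathscr C$, and ${\rm Hom}_{[\mathscr C]_\oplus}(i,j)$ is the split Grothendieck group of the additive category $\mathscr C(i,j)$ (the free abelian group on isomorphism classes of objects modulo $[Y]-[X]-[Z]$ whenever $Y\cong X\oplus Z$), with composition $[M]\circ[N]=[M\circ N]$. The category $K\otimes_{\mathbb Z}[\mathscr C]_\oplus$ is obtained by tensoring all morphism groups with $K$. An additive 2-category $\mathscr C$ is called a categorification of a $K$-linear category $\mathscr D$ if $K\otimes_{\mathbb Z}[\mathscr C]_\oplus$ is isomorphic to $\mathscr D$; in this case $\mathscr D$ is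 called a $K$-decategorification of $\mathscr C$. $\mathscr C_{\mathcal C}$ denotes the additive 2-category with a single object $i$, with $\mathscr C_{\mathcal C}(i,i)=\mathcal C$ and composition $M\circ N=M\otimes N$. A $K$-algebra $A$ is regarded as the $K$-linear category with a single object whose endomorphism algebra is $A$, with composition $a\circ b=ab$. *)

theory Defs
  imports "HOL-Algebra.Algebraic_Closure" "HOL-Algebra.Free_Abelian_Groups"
    "HOL-Algebra.Generated_Groups" "HOL-Algebra.Module"
begin

(* frees the name X *)
no_notation var ("X\<index>")

section \<open>Categories, functors and bifunctors\<close>

text \<open>
  The values of the record fields matter only on objects and on composable (parallel, \<dots>)
  morphisms; they are arbitrary elsewhere.
\<close>

record ('o, 'm) cat_data =
  Obj :: "'o set"
  Hom :: "'o \<Rightarrow> 'o \<Rightarrow> 'm set"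
  Comp :: "'m \<Rightarrow> 'm \<Rightarrow> 'm" (infixl "\<cdot>\<index>" 70)
  Ident :: "'o \<Rightarrow> 'm"

locale category =
  fixes C :: "('o, 'm, 'z) cat_data_scheme" (structure)
  assumes hom_disjoint:
      "\<lbrakk>X \<in> Obj C; Y \<in> Obj C; X' \<in> Obj C; Y' \<in> Obj C; f \<in> Hom C X Y; f \<in> Hom C X' Y'\<rbrakk>
        \<Longrightarrow> X = X' \<and> Y = Y'"
    and comp_closed:
      "\<lbrakk>X \<in> Obj C; Y \<in> Obj C; Z \<in> Obj C; f \<in> Hom C X Y; g \<in> Hom C Y Z\<rbrakk>
        \<Longrightarrow> g \<cdot> f \<in> Hom C X Z"
    and comp_assoc:
      "\<lbrakk>W \<in> Obj C; X \<in> Obj C; Y \<in> Obj C; Z \<in> Obj C;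
        f \<in> Hom C W X; g \<in> Hom C X Y; h \<in> Hom C Y Z\<rbrakk> \<Longrightarrow> (h \<cdot> g) \<cdot> f = h \<cdot> (g \<cdot> f)"
    and ident_closed: "X \<in> Obj C \<Longrightarrow> Ident C X \<in> Hom C X X"
    and ident_left: "\<lbrakk>X \<in> Obj C; Y \<in> Obj C; f \<in> Hom C X Y\<rbrakk> \<Longrightarrow> Ident C Y \<cdot> f = f"
    and ident_right: "\<lbrakk>X \<in> Obj C; Y \<in> Obj C; f \<in> Hom C X Y\<rbrakk> \<Longrightarrow> f \<cdot> Ident C X = f"

definition iso_mor :: "('o, 'm, 'z) cat_data_scheme \<Rightarrow> 'm \<Rightarrow> 'o \<Rightarrow> 'o \<Rightarrow> bool" where
  "iso_mor C f X Y \<longleftrightarrow> f \<in> Hom C X Y \<and>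
     (\<exists>g \<in> Hom C Y X. g \<cdot>\<^bsub>C\<^esub> f = Ident C X \<and> f \<cdot>\<^bsub>C\<^esub> g = Ident C Y)"

definition isomorphic :: "('o, 'm, 'z) cat_data_scheme \<Rightarrow> 'o \<Rightarrow> 'o \<Rightarrow> bool" where
  "isomorphic C X Y \<longleftrightarrow> X \<in> Obj C \<and> Y \<in> Obj C \<and> (\<exists>f. iso_mor C f X Y)"

definition iso_class :: "('o, 'm, 'z) cat_data_scheme \<Rightarrow> 'o \<Rightarrow> 'o set" where
  "iso_class C X = {Y. isomorphic C X Y}"

definition iso_classes :: "('o, 'm, 'z) cat_data_scheme \<Rightarrow> 'o set set" where
  "iso_classes C = iso_class C ` Obj C"

locale bifunctor = A: category A + B: category B + D: category D
  for A :: "('a, 'f, 'x) cat_data_scheme" and B :: "('b, 'g, 'y) cat_data_scheme"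
    and D :: "('d, 'h, 'z) cat_data_scheme" +
  fixes Fo :: "'a \<Rightarrow> 'b \<Rightarrow> 'd" and Fm :: "'f \<Rightarrow> 'g \<Rightarrow> 'h"
  assumes obj_closed: "\<lbrakk>X \<in> Obj A; Y \<in> Obj B\<rbrakk> \<Longrightarrow> Fo X Y \<in> Obj D"
    and mor_closed:
      "\<lbrakk>X \<in> Obj A; X' \<in> Obj A; Y \<in> Obj B; Y' \<in> Obj B; f \<in> Hom A X X'; g \<in> Hom B Y Y'\<rbrakk>
        \<Longrightarrow> Fm f g \<in> Hom D (Fo X Y) (Fo X' Y')"
    and mor_ident:
      "\<lbrakk>X \<in> Obj A; Y \<in> Obj B\<rbrakk> \<Longrightarrow> Fm (Ident A X) (Ident B Y) = Ident D (Fo X Y)"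
    and mor_comp:
      "\<lbrakk>X \<in> Obj A; X' \<in> Obj A; X'' \<in> Obj A; Y \<in> Obj B; Y' \<in> Obj B; Y'' \<in> Obj B;
        f \<in> Hom A X X'; f' \<in> Hom A X' X''; g \<in> Hom B Y Y'; g' \<in> Hom B Y' Y''\<rbrakk>
        \<Longrightarrow> Fm (f' \<cdot>\<^bsub>A\<^esub> f) (g' \<cdot>\<^bsub>B\<^esub> g) = Fm f' g' \<cdot>\<^bsub>D\<^esub> Fm f g"


section \<open>Additive and Krull-Schmidt categories\<close>

record ('o, 'm) preadd_data = "('o, 'm) cat_data" +
  Add :: "'m \<Rightarrow> 'm \<Rightarrow> 'm" (infixl "\<boxplus>\<index>" 65)
  Zero :: "'o \<Rightarrow> 'o \<Rightarrow> 'm"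

definition hom_group :: "('o, 'm, 'z) preadd_data_scheme \<Rightarrow> 'o \<Rightarrow> 'o \<Rightarrow> 'm monoid" where
  "hom_group C X Y = \<lparr>carrier = Hom C X Y, monoid.mult = Add C, one = Zero C X Y\<rparr>"

locale preadditive_category = category C
  for C :: "('o, 'm, 'z) preadd_data_scheme" (structure) +
  assumes hom_comm_group: "\<lbrakk>X \<in> Obj C; Y \<in> Obj C\<rbrakk> \<Longrightarrow> comm_group (hom_group C X Y)"
    and comp_add_left:
      "\<lbrakk>X \<in> Obj C; Y \<in> Obj C; Z \<in> Obj C; f \<in> Hom C X Y; g \<in> Hom C Y Z; g' \<in> Hom C Y Z\<rbrakk>
        \<Longrightarrow> (g \<boxplus> g') \<cdot> f = (g \<cdot> f) \<boxplus> (g' \<cdot> f)"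
    and comp_add_right:
      "\<lbrakk>X \<in> Obj C; Y \<in> Obj C; Z \<in> Obj C; f \<in> Hom C X Y; f' \<in> Hom C X Y; g \<in> Hom C Y Z\<rbrakk>
        \<Longrightarrow> g \<cdot> (f \<boxplus> f') = (g \<cdot> f) \<boxplus> (g \<cdot> f')"

definition zero_object :: "('o, 'm, 'z) cat_data_scheme \<Rightarrow> 'o \<Rightarrow> bool" where
  "zero_object C Z \<longleftrightarrow> Z \<in> Obj C \<and>
     (\<forall>X \<in> Obj C. (\<exists>!f. f \<in> Hom C X Z) \<and> (\<exists>!f. f \<in> Hom C Z X))"

text \<open>\<open>direct_sum C S X Y\<close>: the object \<open>S\<close> is a biproduct of \<open>X\<close> and \<open>Y\<close>.\<close>

definition direct_sum :: "('o, 'm, 'z) preadd_data_scheme \<Rightarrow> 'o \<Rightarrow> 'o \<Rightarrow> 'o \<Rightarrow> bool" where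
  "direct_sum C S X Y \<longleftrightarrow> S \<in> Obj C \<and> X \<in> Obj C \<and> Y \<in> Obj C \<and>
     (\<exists>i \<in> Hom C X S. \<exists>j \<in> Hom C Y S. \<exists>p \<in> Hom C S X. \<exists>q \<in> Hom C S Y.
        p \<cdot>\<^bsub>C\<^esub> i = Ident C X \<and> q \<cdot>\<^bsub>C\<^esub> j = Ident C Y \<and>
        q \<cdot>\<^bsub>C\<^esub> i = Zero C X Y \<and> p \<cdot>\<^bsub>C\<^esub> j = Zero C Y X \<and>
        (i \<cdot>\<^bsub>C\<^esub> p) \<boxplus>\<^bsub>C\<^esub> (j \<cdot>\<^bsub>C\<^esub> q) = Ident C S)"

locale additive_category = preadditive_category C
  for C :: "('o, 'm, 'z) preadd_data_scheme" (structure) +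
  assumes ex_zero_object: "\<exists>Z. zero_object C Z"
    and ex_direct_sum: "\<lbrakk>X \<in> Obj C; Y \<in> Obj C\<rbrakk> \<Longrightarrow> \<exists>S. direct_sum C S X Y"

locale additive_bifunctor = bifunctor A B D Fo Fm +
    A: preadditive_category A + B: preadditive_category B + D: preadditive_category D
  for A :: "('a, 'f, 'x) preadd_data_scheme" and B :: "('b, 'g, 'y) preadd_data_scheme"
    and D :: "('d, 'h, 'z) preadd_data_scheme" and Fo Fm +
  assumes mor_add_left:
      "\<lbrakk>X \<in> Obj A; X' \<in> Obj A; Y \<in> Obj B; Y' \<in> Obj B;
        f \<in> Hom A X X'; f' \<in> Hom A X X'; g \<in> Hom B Y Y'\<rbrakk>
        \<Longrightarrow> Fm (f \<boxplus>\<^bsub>A\<^esub> f') g = Fm f g \<boxplus>\<^bsub>D\<^esub> Fm f' g"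
    and mor_add_right:
      "\<lbrakk>X \<in> Obj A; X' \<in> Obj A; Y \<in> Obj B; Y' \<in> Obj B;
        f \<in> Hom A X X'; g \<in> Hom B Y Y'; g' \<in> Hom B Y Y'\<rbrakk>
        \<Longrightarrow> Fm f (g \<boxplus>\<^bsub>B\<^esub> g') = Fm f g \<boxplus>\<^bsub>D\<^esub> Fm f g'"

primrec finite_direct_sum ::
    "('o, 'm, 'z) preadd_data_scheme \<Rightarrow> 'o \<Rightarrow> 'o list \<Rightarrow> bool" where
  "finite_direct_sum C S [] \<longleftrightarrow> zero_object C S"
| "finite_direct_sum C S (X # Xs) \<longleftrightarrow> (\<exists>S'. finite_direct_sum C S' Xs \<and> direct_sum C S X S')"

definition End_ring :: "('o, 'm, 'z) preadd_data_scheme \<Rightarrow> 'o \<Rightarrow> 'm ring" where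
  "End_ring C X = \<lparr>carrier = Hom C X X, monoid.mult = Comp C, one = Ident C X,
                   ring.zero = Zero C X X, ring.add = Add C\<rparr>"

text \<open>
  A (not necessarily commutative) ring is local if its non-units form a two-sided ideal; the zero
  ring is thereby excluded, since its set of non-units is empty.
\<close>

definition local_ring :: "('a, 'z) ring_scheme \<Rightarrow> bool" where
  "local_ring R \<longleftrightarrow> ring R \<and> ideal (carrier R - Units R) R"

locale krull_schmidt_category = additive_category C
  for C :: "('o, 'm, 'z) preadd_data_scheme" (structure) +
  assumes krull_schmidt:
    "X \<in> Obj C \<Longrightarrow>
       \<exists>Xs. set Xs \<subseteq> Obj C \<and> (\<forall>Y \<in> set Xs. local_ring (End_ring C Y)) \<and> finite_direct_sum C X Xs"


section \<open>Monoidal categories\<close>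

record ('o, 'm) monoidal_data = "('o, 'm) preadd_data" +
  TObj :: "'o \<Rightarrow> 'o \<Rightarrow> 'o" (infixl "\<otimes>\<^sub>o\<index>" 75)
  TMor :: "'m \<Rightarrow> 'm \<Rightarrow> 'm" (infixl "\<otimes>\<^sub>m\<index>" 75)
  TUnit :: "'o"
  Assoc :: "'o \<Rightarrow> 'o \<Rightarrow> 'o \<Rightarrow> 'm"
  LUnit :: "'o \<Rightarrow> 'm"
  RUnit :: "'o \<Rightarrow> 'm"

locale monoidal_category = category C + tensor: bifunctor C C C "TObj C" "TMor C"
  for C :: "('o, 'm, 'z) monoidal_data_scheme" (structure) +
  assumes unit_obj: "TUnit C \<in> Obj C"
    and assoc_iso:
      "\<lbrakk>X \<in> Obj C; Y \<in> Obj C; Z \<in> Obj C\<rbrakk>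
        \<Longrightarrow> iso_mor C (Assoc C X Y Z) ((X \<otimes>\<^sub>o Y) \<otimes>\<^sub>o Z) (X \<otimes>\<^sub>o (Y \<otimes>\<^sub>o Z))"
    and assoc_natural:
      "\<lbrakk>X \<in> Obj C; Y \<in> Obj C; Z \<in> Obj C; X' \<in> Obj C; Y' \<in> Obj C; Z' \<in> Obj C;
        f \<in> Hom C X X'; g \<in> Hom C Y Y'; h \<in> Hom C Z Z'\<rbrakk>
        \<Longrightarrow> Assoc C X' Y' Z' \<cdot> ((f \<otimes>\<^sub>m g) \<otimes>\<^sub>m h) = (f \<otimes>\<^sub>m (g \<otimes>\<^sub>m h)) \<cdot> Assoc C X Y Z"
    and lunit_iso: "X \<in> Obj C \<Longrightarrow> iso_mor C (LUnit C X) (TUnit C \<otimes>\<^sub>o X) X"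
    and lunit_natural:
      "\<lbrakk>X \<in> Obj C; X' \<in> Obj C; f \<in> Hom C X X'\<rbrakk>
        \<Longrightarrow> LUnit C X' \<cdot> (Ident C (TUnit C) \<otimes>\<^sub>m f) = f \<cdot> LUnit C X"
    and runit_iso: "X \<in> Obj C \<Longrightarrow> iso_mor C (RUnit C X) (X \<otimes>\<^sub>o TUnit C) X"
    and runit_natural:
      "\<lbrakk>X \<in> Obj C; X' \<in> Obj C; f \<in> Hom C X X'\<rbrakk>
        \<Longrightarrow> RUnit C X' \<cdot> (f \<otimes>\<^sub>m Ident C (TUnit C)) = f \<cdot> RUnit C X"
    and pentagon:
      "\<lbrakk>W \<in> Obj C; X \<in> Obj C; Y \<in> Obj C; Z \<in> Obj C\<rbrakk>
        \<Longrightarrow> (Ident C W \<otimes>\<^sub>m Assoc C X Y Z) \<cdot> Assoc C W (X \<otimes>\<^sub>o Y) Z \<cdot> (Assoc C W X Y \<otimes>\<^sub>m Ident C Z)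
          = Assoc C W X (Y \<otimes>\<^sub>o Z) \<cdot> Assoc C (W \<otimes>\<^sub>o X) Y Z"
    and triangle:
      "\<lbrakk>X \<in> Obj C; Y \<in> Obj C\<rbrakk>
        \<Longrightarrow> (Ident C X \<otimes>\<^sub>m LUnit C Y) \<cdot> Assoc C X (TUnit C) Y = RUnit C X \<otimes>\<^sub>m Ident C Y"


section \<open>Additive 2-categories\<close>

text \<open>
  A 2-category here is a category weakly enriched in additive categories: composition of
  1-morphisms is associative and unital up to coherent natural isomorphism, because the tensor
  product of a monoidal category, which serves as such a composition below, is in general not
  strictly associative. Strict 2-categories are the case in which \<open>HAssoc\<close>, \<open>HLUnit\<close> and
  \<open>HRUnit\<close> consist of identities. For \<open>M\<close> in \<open>HomCat j k\<close> and \<open>N\<close> in \<open>HomCat i j\<close>, the composite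
  of \<open>M\<close> after \<open>N\<close> is \<open>HObj i j k M N\<close>.
\<close>

record ('i, 'o, 'm) two_cat_data =
  Cells :: "'i set"
  HomCat :: "'i \<Rightarrow> 'i \<Rightarrow> ('o, 'm) preadd_data"
  HObj :: "'i \<Rightarrow> 'i \<Rightarrow> 'i \<Rightarrow> 'o \<Rightarrow> 'o \<Rightarrow> 'o"
  HMor :: "'i \<Rightarrow> 'i \<Rightarrow> 'i \<Rightarrow> 'm \<Rightarrow> 'm \<Rightarrow> 'm"
  HUnit :: "'i \<Rightarrow> 'o"
  HAssoc :: "'i \<Rightarrow> 'i \<Rightarrow> 'i \<Rightarrow> 'i \<Rightarrow> 'o \<Rightarrow> 'o \<Rightarrow> 'o \<Rightarrow> 'm"
  HLUnit :: "'i \<Rightarrow> 'i \<Rightarrow> 'o \<Rightarrow> 'm"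
  HRUnit :: "'i \<Rightarrow> 'i \<Rightarrow> 'o \<Rightarrow> 'm"

locale additive_2category =
  fixes S :: "('i, 'o, 'm, 'z) two_cat_data_scheme"
  assumes hom_additive:
      "\<lbrakk>i \<in> Cells S; j \<in> Cells S\<rbrakk> \<Longrightarrow> additive_category (HomCat S i j)"
    and hcomp_additive_bifunctor:
      "\<lbrakk>i \<in> Cells S; j \<in> Cells S; k \<in> Cells S\<rbrakk>
        \<Longrightarrow> additive_bifunctor (HomCat S j k) (HomCat S i j) (HomCat S i k)
              (HObj S i j k) (HMor S i j k)"
    and hunit_obj: "i \<in> Cells S \<Longrightarrow> HUnit S i \<in> Obj (HomCat S i i)"
    and hassoc_iso:
      "\<lbrakk>i \<in> Cells S; j \<in> Cells S; k \<in> Cells S; l \<in> Cells S;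
        M \<in> Obj (HomCat S k l); N \<in> Obj (HomCat S j k); P \<in> Obj (HomCat S i j)\<rbrakk>
        \<Longrightarrow> iso_mor (HomCat S i l) (HAssoc S i j k l M N P)
              (HObj S i j l (HObj S j k l M N) P) (HObj S i k l M (HObj S i j k N P))"
    and hassoc_natural:
      "\<lbrakk>i \<in> Cells S; j \<in> Cells S; k \<in> Cells S; l \<in> Cells S;
        M \<in> Obj (HomCat S k l); N \<in> Obj (HomCat S j k); P \<in> Obj (HomCat S i j);
        M' \<in> Obj (HomCat S k l); N' \<in> Obj (HomCat S j k); P' \<in> Obj (HomCat S i j);
        f \<in> Hom (HomCat S k l) M M'; g \<in> Hom (HomCat S j k) N N'; h \<in> Hom (HomCat S i j) P P'\<rbrakk>
        \<Longrightarrow> HAssoc S i j k l M' N' P' \<cdot>\<^bsub>HomCat S i l\<^esub> HMor S i j l (HMor S j k l f g) h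
          = HMor S i k l f (HMor S i j k g h) \<cdot>\<^bsub>HomCat S i l\<^esub> HAssoc S i j k l M N P"
    and hlunit_iso:
      "\<lbrakk>i \<in> Cells S; j \<in> Cells S; M \<in> Obj (HomCat S i j)\<rbrakk>
        \<Longrightarrow> iso_mor (HomCat S i j) (HLUnit S i j M) (HObj S i j j (HUnit S j) M) M"
    and hlunit_natural:
      "\<lbrakk>i \<in> Cells S; j \<in> Cells S; M \<in> Obj (HomCat S i j); M' \<in> Obj (HomCat S i j);
        f \<in> Hom (HomCat S i j) M M'\<rbrakk>
        \<Longrightarrow> HLUnit S i j M' \<cdot>\<^bsub>HomCat S i j\<^esub> HMor S i j j (Ident (HomCat S j j) (HUnit S j)) f
          = f \<cdot>\<^bsub>HomCat S i j\<^esub> HLUnit S i j M"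
    and hrunit_iso:
      "\<lbrakk>i \<in> Cells S; j \<in> Cells S; M \<in> Obj (HomCat S i j)\<rbrakk>
        \<Longrightarrow> iso_mor (HomCat S i j) (HRUnit S i j M) (HObj S i i j M (HUnit S i)) M"
    and hrunit_natural:
      "\<lbrakk>i \<in> Cells S; j \<in> Cells S; M \<in> Obj (HomCat S i j); M' \<in> Obj (HomCat S i j);
        f \<in> Hom (HomCat S i j) M M'\<rbrakk>
        \<Longrightarrow> HRUnit S i j M' \<cdot>\<^bsub>HomCat S i j\<^esub> HMor S i i j f (Ident (HomCat S i i) (HUnit S i))
          = f \<cdot>\<^bsub>HomCat S i j\<^esub> HRUnit S i j M"
    and hpentagon:
      "\<lbrakk>i \<in> Cells S; j \<in> Cells S; k \<in> Cells S; l \<in> Cells S; n \<in> Cells S;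
        L \<in> Obj (HomCat S l n); M \<in> Obj (HomCat S k l);
        N \<in> Obj (HomCat S j k); P \<in> Obj (HomCat S i j)\<rbrakk>
        \<Longrightarrow> HMor S i l n (Ident (HomCat S l n) L) (HAssoc S i j k l M N P)
              \<cdot>\<^bsub>HomCat S i n\<^esub> HAssoc S i j l n L (HObj S j k l M N) P
              \<cdot>\<^bsub>HomCat S i n\<^esub> HMor S i j n (HAssoc S j k l n L M N) (Ident (HomCat S i j) P)
          = HAssoc S i k l n L M (HObj S i j k N P)
              \<cdot>\<^bsub>HomCat S i n\<^esub> HAssoc S i j k n (HObj S k l n L M) N P"
    and htriangle:
      "\<lbrakk>i \<in> Cells S; j \<in> Cells S; k \<in> Cells S;
        M \<in> Obj (HomCat S j k); N \<in> Obj (HomCat S i j)\<rbrakk>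
        \<Longrightarrow> HMor S i j k (Ident (HomCat S j k) M) (HLUnit S i j N)
              \<cdot>\<^bsub>HomCat S i k\<^esub> HAssoc S i j j k M (HUnit S j) N
          = HMor S i j k (HRUnit S j k M) (Ident (HomCat S i j) N)"

text \<open>The one-object additive 2-category of a monoidal category.\<close>

definition one_object_2category :: "('o, 'm) monoidal_data \<Rightarrow> (unit, 'o, 'm) two_cat_data" where
  "one_object_2category C =
     \<lparr>Cells = {()},
      HomCat = (\<lambda>_ _. preadd_data.truncate C),
      HObj = (\<lambda>_ _ _. TObj C),
      HMor = (\<lambda>_ _ _. TMor C),
      HUnit = (\<lambda>_. TUnit C),
      HAssoc = (\<lambda>_ _ _ _. Assoc C),
      HLUnit = (\<lambda>_ _. LUnit C),
      HRUnit = (\<lambda>_ _. RUnit C)\<rparr>"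


section \<open>Abelian groups given by generators and relations\<close>

definition presented_group :: "'a set \<Rightarrow> ('a \<Rightarrow>\<^sub>0 int) set \<Rightarrow> ('a \<Rightarrow>\<^sub>0 int) set monoid" where
  "presented_group S R = free_Abelian_group S Mod generate (free_Abelian_group S) R"

definition presented_class ::
    "'a set \<Rightarrow> ('a \<Rightarrow>\<^sub>0 int) set \<Rightarrow> ('a \<Rightarrow>\<^sub>0 int) \<Rightarrow> ('a \<Rightarrow>\<^sub>0 int) set" where
  "presented_class S R x = generate (free_Abelian_group S) R #>\<^bsub>free_Abelian_group S\<^esub> x"

text \<open>
  The maps between presented groups induced by the additive extension of \<open>\<phi>\<close>, resp. the biadditive
  extension of \<open>\<beta>\<close>, to free abelian groups. The unions range over representatives of the argument
  classes; whenever the extension respects the relations, all the united sets coincide.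
\<close>

definition presented_linear ::
    "'a set \<Rightarrow> ('a \<Rightarrow>\<^sub>0 int) set \<Rightarrow> ('b \<Rightarrow> 'a \<Rightarrow>\<^sub>0 int) \<Rightarrow> ('b \<Rightarrow>\<^sub>0 int) set \<Rightarrow> ('a \<Rightarrow>\<^sub>0 int) set" where
  "presented_linear S R \<phi> U = (\<Union>u \<in> U. presented_class S R (frag_extend \<phi> u))"

definition presented_bilinear ::
    "'a set \<Rightarrow> ('a \<Rightarrow>\<^sub>0 int) set \<Rightarrow> ('b \<Rightarrow> 'c \<Rightarrow> 'a \<Rightarrow>\<^sub>0 int)
      \<Rightarrow> ('b \<Rightarrow>\<^sub>0 int) set \<Rightarrow> ('c \<Rightarrow>\<^sub>0 int) set \<Rightarrow> ('a \<Rightarrow>\<^sub>0 int) set" where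
  "presented_bilinear S R \<beta> U V =
     (\<Union>u \<in> U. \<Union>v \<in> V. presented_class S R (frag_extend (\<lambda>x. frag_extend (\<beta> x) v) u))"


section \<open>Extension of scalars from the integers\<close>

text \<open>
  The abelian group \<open>A\<close> is written multiplicatively, as a group record. Over the
  integers, balancedness \<open>(n k, a) = (k, n a)\<close> is a consequence of biadditivity.
\<close>

definition tensor_rels ::
    "('k, 'e) ring_scheme \<Rightarrow> ('a, 'f) monoid_scheme \<Rightarrow> ('k \<times> 'a \<Rightarrow>\<^sub>0 int) set" where
  "tensor_rels K A =
     {frag_of (k \<oplus>\<^bsub>K\<^esub> l, a) - frag_of (k, a) - frag_of (l, a) | k l a.
        k \<in> carrier K \<and> l \<in> carrier K \<and> a \<in> carrier A} \<union>
     {frag_of (k, a \<otimes>\<^bsub>A\<^esub> b) - frag_of (k, a) - frag_of (k, b) | k a b.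
        k \<in> carrier K \<and> a \<in> carrier A \<and> b \<in> carrier A}"

definition tensor_group ::
    "('k, 'e) ring_scheme \<Rightarrow> ('a, 'f) monoid_scheme \<Rightarrow> ('k \<times> 'a \<Rightarrow>\<^sub>0 int) set monoid" where
  "tensor_group K A = presented_group (carrier K \<times> carrier A) (tensor_rels K A)"

definition pure_tensor ::
    "('k, 'e) ring_scheme \<Rightarrow> ('a, 'f) monoid_scheme \<Rightarrow> 'k \<Rightarrow> 'a \<Rightarrow> ('k \<times> 'a \<Rightarrow>\<^sub>0 int) set" where
  "pure_tensor K A k a =
     presented_class (carrier K \<times> carrier A) (tensor_rels K A) (frag_of (k, a))"

definition tensor_smult ::
    "('k, 'e) ring_scheme \<Rightarrow> ('a, 'f) monoid_scheme
      \<Rightarrow> 'k \<Rightarrow> ('k \<times> 'a \<Rightarrow>\<^sub>0 int) set \<Rightarrow> ('k \<times> 'a \<Rightarrow>\<^sub>0 int) set" where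
  "tensor_smult K A c =
     presented_linear (carrier K \<times> carrier A) (tensor_rels K A)
       (\<lambda>(k, a). frag_of (c \<otimes>\<^bsub>K\<^esub> k, a))"

text \<open>
  For a biadditive map \<open>\<mu>\<close> with values in \<open>A\<close>, the induced map on scalar extensions sends the pure
  tensors of \<open>(k, b)\<close> and \<open>(l, c)\<close> to that of \<open>(k l, \<mu> b c)\<close>.
\<close>

definition tensor_mult ::
    "('k, 'e) ring_scheme \<Rightarrow> ('a, 'f) monoid_scheme \<Rightarrow> ('b \<Rightarrow> 'c \<Rightarrow> 'a)
      \<Rightarrow> ('k \<times> 'b \<Rightarrow>\<^sub>0 int) set \<Rightarrow> ('k \<times> 'c \<Rightarrow>\<^sub>0 int) set \<Rightarrow> ('k \<times> 'a \<Rightarrow>\<^sub>0 int) set" where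
  "tensor_mult K A \<mu> =
     presented_bilinear (carrier K \<times> carrier A) (tensor_rels K A)
       (\<lambda>(k, b) (l, c). frag_of (k \<otimes>\<^bsub>K\<^esub> l, \<mu> b c))"


section \<open>The Green ring\<close>

definition green_rels :: "('o, 'm, 'z) preadd_data_scheme \<Rightarrow> ('o set \<Rightarrow>\<^sub>0 int) set" where
  "green_rels C =
     {frag_of (iso_class C X) + frag_of (iso_class C Y) - frag_of (iso_class C S) | X Y S.
        direct_sum C S X Y}"

definition tensor_iso_class ::
    "('o, 'm, 'z) monoidal_data_scheme \<Rightarrow> 'o set \<Rightarrow> 'o set \<Rightarrow> 'o set" where
  "tensor_iso_class C U V = (\<Union>X \<in> U. \<Union>Y \<in> V. iso_class C (X \<otimes>\<^sub>o\<^bsub>C\<^esub> Y))"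

definition green_ring ::
    "('o, 'm, 'z) monoidal_data_scheme \<Rightarrow> ('o set \<Rightarrow>\<^sub>0 int) set ring" where
  "green_ring C =
     (let G = presented_group (iso_classes C) (green_rels C) in
      \<lparr>carrier = carrier G,
       monoid.mult = presented_bilinear (iso_classes C) (green_rels C)
                (\<lambda>U V. frag_of (tensor_iso_class C U V)),
       one = presented_class (iso_classes C) (green_rels C) (frag_of (iso_class C (TUnit C))),
       ring.zero = \<one>\<^bsub>G\<^esub>,
       ring.add = monoid.mult G\<rparr>)"

definition scalar_extension_algebra ::
    "('k, 'e) ring_scheme \<Rightarrow> ('a, 'f) ring_scheme \<Rightarrow> ('k, ('k \<times> 'a \<Rightarrow>\<^sub>0 int) set) module" where
  "scalar_extension_algebra K R =
     (let A = add_monoid R; T = tensor_group K A in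
      \<lparr>carrier = carrier T,
       monoid.mult = tensor_mult K A (monoid.mult R),
       one = pure_tensor K A \<one>\<^bsub>K\<^esub> \<one>\<^bsub>R\<^esub>,
       ring.zero = \<one>\<^bsub>T\<^esub>,
       ring.add = monoid.mult T,
       module.smult = tensor_smult K A\<rparr>)"

definition K_green_ring ::
    "('k, 'e) ring_scheme \<Rightarrow> ('o, 'm, 'z) monoidal_data_scheme
      \<Rightarrow> ('k, ('k \<times> ('o set \<Rightarrow>\<^sub>0 int) set \<Rightarrow>\<^sub>0 int) set) module" where
  "K_green_ring K C = scalar_extension_algebra K (green_ring C)"


section \<open>The split Grothendieck category\<close>

definition split_rels :: "('o, 'm, 'z) preadd_data_scheme \<Rightarrow> ('o set \<Rightarrow>\<^sub>0 int) set" where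
  "split_rels C =
     {frag_of (iso_class C Y) - frag_of (iso_class C X) - frag_of (iso_class C Z) | X Y Z.
        \<exists>S. direct_sum C S X Z \<and> isomorphic C Y S}"

definition split_grothendieck_group ::
    "('o, 'm, 'z) preadd_data_scheme \<Rightarrow> ('o set \<Rightarrow>\<^sub>0 int) set monoid" where
  "split_grothendieck_group C = presented_group (iso_classes C) (split_rels C)"

definition hcomp_iso_class ::
    "('i, 'o, 'm, 'z) two_cat_data_scheme \<Rightarrow> 'i \<Rightarrow> 'i \<Rightarrow> 'i \<Rightarrow> 'o set \<Rightarrow> 'o set \<Rightarrow> 'o set" where
  "hcomp_iso_class S i j k U V =
     (\<Union>M \<in> U. \<Union>N \<in> V. iso_class (HomCat S i k) (HObj S i j k M N))"

text \<open>A morphism from \<open>i\<close> to \<open>j\<close> is tagged with \<open>i\<close> and \<open>j\<close> to keep hom-sets disjoint.\<close>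

definition split_grothendieck_category ::
    "('i, 'o, 'm, 'z) two_cat_data_scheme \<Rightarrow> ('i, 'i \<times> 'i \<times> ('o set \<Rightarrow>\<^sub>0 int) set) preadd_data" where
  "split_grothendieck_category S =
     \<lparr>Obj = Cells S,
      Hom = (\<lambda>i j. {(i, j, U) | U. U \<in> carrier (split_grothendieck_group (HomCat S i j))}),
      Comp = (\<lambda>(j, k, U) (i, _, V).
        (i, k, presented_bilinear (iso_classes (HomCat S i k)) (split_rels (HomCat S i k))
                 (\<lambda>u v. frag_of (hcomp_iso_class S i j k u v)) U V)),
      Ident = (\<lambda>i.
        (i, i, presented_class (iso_classes (HomCat S i i)) (split_rels (HomCat S i i))
                 (frag_of (iso_class (HomCat S i i) (HUnit S i))))),
      Add = (\<lambda>(i, j, U) (_, _, V). (i, j, U \<otimes>\<^bsub>split_grothendieck_group (HomCat S i j)\<^esub> V)),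
      Zero = (\<lambda>i j. (i, j, \<one>\<^bsub>split_grothendieck_group (HomCat S i j)\<^esub>))\<rparr>"


section \<open>Linear categories and decategorification\<close>

record ('o, 'm, 'k) linear_data = "('o, 'm) preadd_data" +
  Scal :: "'k \<Rightarrow> 'm \<Rightarrow> 'm"

text \<open>The record type of modules extends that of rings; the \<open>mult\<close> and \<open>one\<close> fields are unused.\<close>

definition hom_module :: "('o, 'm, 'k, 'z) linear_data_scheme \<Rightarrow> 'o \<Rightarrow> 'o \<Rightarrow> ('k, 'm) module" where
  "hom_module D X Y =
     \<lparr>carrier = Hom D X Y, monoid.mult = (\<lambda>_ _. undefined), one = undefined,
      ring.zero = Zero D X Y, ring.add = Add D, module.smult = Scal D\<rparr>"

locale linear_category = preadditive_category D
  for K :: "('k, 'e) ring_scheme" and D :: "('o, 'm, 'k, 'z) linear_data_scheme" +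
  assumes hom_is_module: "\<lbrakk>X \<in> Obj D; Y \<in> Obj D\<rbrakk> \<Longrightarrow> module K (hom_module D X Y)"
    and comp_scal_left:
      "\<lbrakk>X \<in> Obj D; Y \<in> Obj D; Z \<in> Obj D; c \<in> carrier K; f \<in> Hom D X Y; g \<in> Hom D Y Z\<rbrakk>
        \<Longrightarrow> Scal D c g \<cdot>\<^bsub>D\<^esub> f = Scal D c (g \<cdot>\<^bsub>D\<^esub> f)"
    and comp_scal_right:
      "\<lbrakk>X \<in> Obj D; Y \<in> Obj D; Z \<in> Obj D; c \<in> carrier K; f \<in> Hom D X Y; g \<in> Hom D Y Z\<rbrakk>
        \<Longrightarrow> g \<cdot>\<^bsub>D\<^esub> Scal D c f = Scal D c (g \<cdot>\<^bsub>D\<^esub> f)"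

locale linear_functor = D: linear_category K D + E: linear_category K E
  for K :: "('k, 'e) ring_scheme" and D :: "('o, 'm, 'k, 'z) linear_data_scheme"
    and E :: "('p, 'n, 'k, 'y) linear_data_scheme" +
  fixes Fo :: "'o \<Rightarrow> 'p" and Fm :: "'m \<Rightarrow> 'n"
  assumes fobj_closed: "X \<in> Obj D \<Longrightarrow> Fo X \<in> Obj E"
    and fmor_closed: "\<lbrakk>X \<in> Obj D; Y \<in> Obj D; f \<in> Hom D X Y\<rbrakk> \<Longrightarrow> Fm f \<in> Hom E (Fo X) (Fo Y)"
    and fmor_ident: "X \<in> Obj D \<Longrightarrow> Fm (Ident D X) = Ident E (Fo X)"
    and fmor_comp:
      "\<lbrakk>X \<in> Obj D; Y \<in> Obj D; Z \<in> Obj D; f \<in> Hom D X Y; g \<in> Hom D Y Z\<rbrakk>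
        \<Longrightarrow> Fm (g \<cdot>\<^bsub>D\<^esub> f) = Fm g \<cdot>\<^bsub>E\<^esub> Fm f"
    and fmor_add:
      "\<lbrakk>X \<in> Obj D; Y \<in> Obj D; f \<in> Hom D X Y; g \<in> Hom D X Y\<rbrakk>
        \<Longrightarrow> Fm (f \<boxplus>\<^bsub>D\<^esub> g) = Fm f \<boxplus>\<^bsub>E\<^esub> Fm g"
    and fmor_scal:
      "\<lbrakk>X \<in> Obj D; Y \<in> Obj D; c \<in> carrier K; f \<in> Hom D X Y\<rbrakk>
        \<Longrightarrow> Fm (Scal D c f) = Scal E c (Fm f)"

text \<open>Isomorphism (not mere equivalence) of linear categories.\<close>

definition linear_isomorphic ::
    "('k, 'e) ring_scheme \<Rightarrow> ('o, 'm, 'k, 'z) linear_data_scheme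
      \<Rightarrow> ('p, 'n, 'k, 'y) linear_data_scheme \<Rightarrow> bool" where
  "linear_isomorphic K D E \<longleftrightarrow>
     (\<exists>Fo Fm Go Gm. linear_functor K D E Fo Fm \<and> linear_functor K E D Go Gm \<and>
        (\<forall>X \<in> Obj D. Go (Fo X) = X) \<and> (\<forall>X \<in> Obj E. Fo (Go X) = X) \<and>
        (\<forall>X \<in> Obj D. \<forall>Y \<in> Obj D. \<forall>f \<in> Hom D X Y. Gm (Fm f) = f) \<and>
        (\<forall>X \<in> Obj E. \<forall>Y \<in> Obj E. \<forall>f \<in> Hom E X Y. Fm (Gm f) = f))"

definition scalar_extension_category ::
    "('k, 'e) ring_scheme \<Rightarrow> ('o, 'm, 'z) preadd_data_scheme
      \<Rightarrow> ('o, 'o \<times> 'o \<times> ('k \<times> 'm \<Rightarrow>\<^sub>0 int) set, 'k) linear_data" where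
  "scalar_extension_category K P =
     \<lparr>Obj = Obj P,
      Hom = (\<lambda>X Y. {(X, Y, s) | s. s \<in> carrier (tensor_group K (hom_group P X Y))}),
      Comp = (\<lambda>(Y, Z, s) (X, _, t). (X, Z, tensor_mult K (hom_group P X Z) (Comp P) s t)),
      Ident = (\<lambda>X. (X, X, pure_tensor K (hom_group P X X) \<one>\<^bsub>K\<^esub> (Ident P X))),
      Add = (\<lambda>(X, Y, s) (_, _, t). (X, Y, s \<otimes>\<^bsub>tensor_group K (hom_group P X Y)\<^esub> t)),
      Zero = (\<lambda>X Y. (X, Y, \<one>\<^bsub>tensor_group K (hom_group P X Y)\<^esub>)),
      Scal = (\<lambda>c (X, Y, s). (X, Y, tensor_smult K (hom_group P X Y) c s))\<rparr>"

text \<open>An algebra, not necessarily commutative, as a linear category with a single object.\<close>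

definition one_object_category :: "('k, 'a, 'z) module_scheme \<Rightarrow> (unit, 'a, 'k) linear_data" where
  "one_object_category A =
     \<lparr>Obj = {()},
      Hom = (\<lambda>_ _. carrier A),
      Comp = monoid.mult A,
      Ident = (\<lambda>_. \<one>\<^bsub>A\<^esub>),
      Add = ring.add A,
      Zero = (\<lambda>_ _. \<zero>\<^bsub>A\<^esub>),
      Scal = module.smult A\<rparr>"

definition categorification ::
    "('k, 'e) ring_scheme \<Rightarrow> ('i, 'o, 'm, 'y) two_cat_data_scheme
      \<Rightarrow> ('p, 'n, 'k, 'z) linear_data_scheme \<Rightarrow> bool" where
  "categorification K S D \<longleftrightarrow>
     additive_2category S \<and> linear_category K D \<and>
     linear_isomorphic K (scalar_extension_category K (split_grothendieck_category S)) D"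

definition decategorification ::
    "('k, 'e) ring_scheme \<Rightarrow> ('p, 'n, 'k, 'z) linear_data_scheme
      \<Rightarrow> ('i, 'o, 'm, 'y) two_cat_data_scheme \<Rightarrow> bool" where
  "decategorification K D S \<longleftrightarrow> categorification K S D"

end

theory Submission
  imports Defs
begin

text \<open>
  Since the 2-category has one object, both sides of the isomorphism are endomorphism algebras, and
  the claim is that they are built from the same data. The endomorphism group of the split
  Grothendieck category is generated by the isomorphism classes of objects; its relations are the
  negatives of those of the Green ring (\<open>relation_span_split_rels\<close>), so both rings are the same
  quotient of a free abelian group. Composition is the tensor product, so the multiplications agree
  too, and the endomorphism ring is the Green ring up to the tags that record source and target
  (\<open>ring_iso_green_End_split\<close>). Extension of scalars is functorial in the ring, so it carries this
  isomorphism to the required one (\<open>one_object_presentation_scalar_extension_category\<close>).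

  The remaining content is that these constructions are well defined and satisfy the laws of linear
  categories. The Green ring and the scalar extension of a ring are both quotients of the
  integral monoid ring of a monoid of generators by a subgroup that multiplication by generators
  preserves, and such a quotient is a ring (\<open>ring_presented_group\<close>). For the Green ring the monoid
  consists of the isomorphism classes under the tensor product, with the monoid laws coming from the
  associativity and unit isomorphisms, and stability of the relations is the fact that tensoring
  with an object preserves direct sums (\<open>direct_sum_tensor_right\<close>, \<open>direct_sum_tensor_left\<close>). For the
  scalar extension the monoid consists of pairs of a scalar and a ring element, and stability is the
  additivity of multiplication in either factor; the quotient is moreover a unital algebra
  (\<open>unital_algebra_ext\<close>). The laws of a unital algebra are those of a linear category with one
  object, and they are transported along the identification of endomorphisms with elements of the
  algebra (\<open>linear_category_one_object\<close>, \<open>linear_isomorphic_one_object\<close>).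
\<close>

section \<open>Presented abelian groups on representatives\<close>

lemma frag_extend_minus_fun:
  "frag_extend (\<lambda>x. f x - g x) u = frag_extend f u - frag_extend g u"
  using subset_UNIV by (induction u rule: frag_induction) (simp_all add: frag_extend_diff)

lemma frag_extend_add_fun:
  "frag_extend (\<lambda>x. f x + g x) u = frag_extend f u + frag_extend g u"
  using subset_UNIV by (induction u rule: frag_induction) (simp_all add: frag_extend_diff)

lemma frag_extend_zero_fun [simp]: "frag_extend (\<lambda>x. 0) u = 0"
  by (rule frag_extend_eq_0) simp

lemma keys_diff_subset:
  "\<lbrakk>Poly_Mapping.keys x \<subseteq> S; Poly_Mapping.keys y \<subseteq> S\<rbrakk> \<Longrightarrow> Poly_Mapping.keys (x - y) \<subseteq> S"
  using keys_diff[of x y] by blast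

lemma keys_add_subset:
  "\<lbrakk>Poly_Mapping.keys x \<subseteq> S; Poly_Mapping.keys y \<subseteq> S\<rbrakk> \<Longrightarrow> Poly_Mapping.keys (x + y) \<subseteq> S"
  using keys_add[of x y] by blast

lemma keys_frag_extend_subset:
  assumes "Poly_Mapping.keys u \<subseteq> S" "\<And>x. x \<in> S \<Longrightarrow> Poly_Mapping.keys (f x) \<subseteq> S'"
  shows "Poly_Mapping.keys (frag_extend f u) \<subseteq> S'"
  using keys_frag_extend[of f u] assms by blast

abbreviation relation_span :: "'a set \<Rightarrow> ('a \<Rightarrow>\<^sub>0 int) set \<Rightarrow> ('a \<Rightarrow>\<^sub>0 int) set" where
  "relation_span S R \<equiv> generate (free_Abelian_group S) R"

text \<open>
  Working with presented groups on representatives: a class is determined by any representative,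
  two representatives are identified when their difference lies in the span of the relations, and
  sums of classes are sums of representatives. All later identities are checked this way, on
  generators of the free abelian group.
\<close>

locale presentation =
  fixes S :: "'a set" and R :: "('a \<Rightarrow>\<^sub>0 int) set"
  assumes keys_rel: "r \<in> R \<Longrightarrow> Poly_Mapping.keys r \<subseteq> S"
begin

lemma subgroup_relation_span: "subgroup (relation_span S R) (free_Abelian_group S)"
  by (rule group.generate_is_subgroup) (auto dest: keys_rel)

lemma normal_relation_span: "relation_span S R \<lhd> free_Abelian_group S"
  using comm_group.normal_iff_subgroup[OF abelian_free_Abelian_group] subgroup_relation_span by blast

lemma keys_relation_span: "n \<in> relation_span S R \<Longrightarrow> Poly_Mapping.keys n \<subseteq> S"
  using subgroup.subset[OF subgroup_relation_span] by (metis carrier_free_Abelian_group_iff subsetD)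

lemma zero_relation_span: "0 \<in> relation_span S R"
  using subgroup.one_closed[OF subgroup_relation_span] by simp

lemma minus_relation_span:
  assumes "n \<in> relation_span S R" shows "- n \<in> relation_span S R"
  using subgroup.m_inv_closed[OF subgroup_relation_span assms] keys_relation_span[OF assms] by simp

lemma add_relation_span:
  "\<lbrakk>n \<in> relation_span S R; n' \<in> relation_span S R\<rbrakk> \<Longrightarrow> n + n' \<in> relation_span S R"
  using subgroup.m_closed[OF subgroup_relation_span] by simp

lemma diff_relation_span:
  "\<lbrakk>n \<in> relation_span S R; n' \<in> relation_span S R\<rbrakk> \<Longrightarrow> n - n' \<in> relation_span S R"
  using add_relation_span[of n "- n'"] minus_relation_span[of n'] by simp

text \<open>
  The span is reached from the relations by differences alone, which matches the induction
  principle for the free abelian group and lets any additive map be tested on the relations only.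
\<close>

lemma relation_span_induct [consumes 1, case_names zero rel diff]:
  assumes "n \<in> relation_span S R"
    and "P 0" "\<And>r. r \<in> R \<Longrightarrow> P r" "\<And>x y. \<lbrakk>P x; P y\<rbrakk> \<Longrightarrow> P (x - y)"
  shows "P n"
  using assms(1)
proof (induction n rule: generate.induct)
  case one then show ?case using assms(2) by simp
next
  case (incl h) then show ?case by (rule assms(3))
next
  case (inv h)
  then show ?case using assms(4)[OF assms(2) assms(3)[OF inv]] keys_rel[OF inv] by simp
next
  case (eng h1 h2)
  then show ?case using assms(4)[OF eng(3) assms(4)[OF assms(2) eng(4)]] by simp
qed

lemma presented_class_iff:
  "z \<in> presented_class S R x \<longleftrightarrow> z - x \<in> relation_span S R"
  unfolding presented_class_def r_coset_def by (force simp: algebra_simps)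

lemma presented_class_self: "x \<in> presented_class S R x"
  by (simp add: presented_class_iff zero_relation_span)

lemma presented_class_eq_iff:
  "presented_class S R x = presented_class S R y \<longleftrightarrow> x - y \<in> relation_span S R"
proof
  assume "presented_class S R x = presented_class S R y"
  then show "x - y \<in> relation_span S R"
    using presented_class_self[of x] by (simp add: presented_class_iff)
next
  assume xy: "x - y \<in> relation_span S R"
  have "z - x \<in> relation_span S R \<longleftrightarrow> z - y \<in> relation_span S R" for z
  proof
    show "z - y \<in> relation_span S R" if "z - x \<in> relation_span S R"
      using add_relation_span[OF that xy] by simp
    show "z - x \<in> relation_span S R" if "z - y \<in> relation_span S R"
      using diff_relation_span[OF that xy] by simp
  qed
  then show "presented_class S R x = presented_class S R y"
    by (simp only: set_eq_iff presented_class_iff simp_thms)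
qed

lemma carrier_presented_group:
  "carrier (presented_group S R) = presented_class S R ` {x. Poly_Mapping.keys x \<subseteq> S}"
  unfolding presented_group_def carrier_FactGroup presented_class_def by auto

lemma presented_group_cases:
  assumes "U \<in> carrier (presented_group S R)"
  obtains u where "Poly_Mapping.keys u \<subseteq> S" "U = presented_class S R u"
  using assms unfolding carrier_presented_group by blast

lemma presented_class_closed [intro]:
  "Poly_Mapping.keys x \<subseteq> S \<Longrightarrow> presented_class S R x \<in> carrier (presented_group S R)"
  unfolding carrier_presented_group by blast

lemma mult_presented_group:
  assumes "Poly_Mapping.keys x \<subseteq> S" "Poly_Mapping.keys y \<subseteq> S"
  shows "presented_class S R x \<otimes>\<^bsub>presented_group S R\<^esub> presented_class S R y = presented_class S R (x + y)"
  using normal.rcos_sum[OF normal_relation_span, of x y] assms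
  unfolding presented_group_def presented_class_def by simp

lemma one_presented_group: "\<one>\<^bsub>presented_group S R\<^esub> = presented_class S R 0"
  by (auto simp: presented_group_def presented_class_iff)

lemma comm_group_presented_group: "comm_group (presented_group S R)"
  unfolding presented_group_def
  by (rule comm_group.abelian_FactGroup[OF abelian_free_Abelian_group subgroup_relation_span])

text \<open>
  The union over representatives in the definition of the induced map collapses to one class as soon
  as the map on free groups sends each relation into the span of the target relations.
\<close>

lemma presented_linear_class:
  assumes "presentation S' R'" and u: "Poly_Mapping.keys u \<subseteq> S'"
    and rel: "\<And>r. r \<in> R' \<Longrightarrow> frag_extend \<phi> r \<in> relation_span S R"
  shows "presented_linear S R \<phi> (presented_class S' R' u) = presented_class S R (frag_extend \<phi> u)"
proof -
  interpret D: presentation S' R' by fact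
  have span: "frag_extend \<phi> n \<in> relation_span S R" if "n \<in> relation_span S' R'" for n
    using that by (induction n rule: D.relation_span_induct)
      (simp_all add: zero_relation_span rel frag_extend_diff diff_relation_span)
  have "presented_class S R (frag_extend \<phi> v) = presented_class S R (frag_extend \<phi> u)"
    if "v \<in> presented_class S' R' u" for v
    using span[of "v - u"] that
    by (simp add: D.presented_class_iff presented_class_eq_iff frag_extend_diff)
  then show ?thesis
    unfolding presented_linear_def using D.presented_class_self[of u] by blast
qed

end

lemma frag_extend_diff_right:
  "frag_extend (\<lambda>x. frag_extend (\<beta> x) (v - w)) u =
    frag_extend (\<lambda>x. frag_extend (\<beta> x) v) u - frag_extend (\<lambda>x. frag_extend (\<beta> x) w) u"
  by (simp add: frag_extend_diff frag_extend_minus_fun)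

text \<open>
  Changing both representatives changes the value by
  \<open>B(u' - u, v') + B(u, v' - v)\<close>. The two terms lie in the span because the biadditive extension
  sends a relation in one argument and a generator in the other into it.
\<close>

lemma (in presentation) presented_bilinear_class:
  fixes \<beta> :: "'b \<Rightarrow> 'c \<Rightarrow> ('a \<Rightarrow>\<^sub>0 int)"
  assumes "presentation S1 R1" "presentation S2 R2"
    and u: "Poly_Mapping.keys u \<subseteq> S1" and v: "Poly_Mapping.keys v \<subseteq> S2"
    and rel1: "\<And>r y. \<lbrakk>r \<in> R1; y \<in> S2\<rbrakk> \<Longrightarrow> frag_extend (\<lambda>x. \<beta> x y) r \<in> relation_span S R"
    and rel2: "\<And>x r. \<lbrakk>x \<in> S1; r \<in> R2\<rbrakk> \<Longrightarrow> frag_extend (\<beta> x) r \<in> relation_span S R"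
  shows "presented_bilinear S R \<beta> (presented_class S1 R1 u) (presented_class S2 R2 v) =
         presented_class S R (frag_extend (\<lambda>x. frag_extend (\<beta> x) v) u)"
proof -
  interpret P1: presentation S1 R1 by fact
  interpret P2: presentation S2 R2 by fact
  let ?B = "\<lambda>u v. frag_extend (\<lambda>x. frag_extend (\<beta> x) v) u"
  have B1: "?B n w \<in> relation_span S R"
    if "n \<in> relation_span S1 R1" "Poly_Mapping.keys w \<subseteq> S2" for n w
    using that(2)
  proof (induction w rule: frag_induction)
    case (one y)
    show ?case
      using that(1) by (induction n rule: P1.relation_span_induct)
        (simp_all add: zero_relation_span rel1[OF _ one] frag_extend_diff diff_relation_span)
  qed (simp_all add: zero_relation_span frag_extend_diff_right diff_relation_span)
  have B2: "?B w n \<in> relation_span S R"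
    if "n \<in> relation_span S2 R2" "Poly_Mapping.keys w \<subseteq> S1" for n w
    using that(2)
  proof (induction w rule: frag_induction)
    case (one x)
    show ?case
      using that(1) by (induction n rule: P2.relation_span_induct)
        (simp_all add: zero_relation_span rel2[OF one] frag_extend_diff diff_relation_span)
  qed (simp_all add: zero_relation_span frag_extend_diff diff_relation_span)
  have eq: "presented_class S R (?B u' v') = presented_class S R (?B u v)"
    if "u' \<in> presented_class S1 R1 u" "v' \<in> presented_class S2 R2 v" for u' v'
  proof -
    have d: "u' - u \<in> relation_span S1 R1" "v' - v \<in> relation_span S2 R2"
      using that P1.presented_class_iff P2.presented_class_iff by auto
    have "Poly_Mapping.keys v' \<subseteq> S2"
      using keys_add_subset[OF P2.keys_relation_span[OF d(2)] v] by simp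
    then have "?B (u' - u) v' + ?B u (v' - v) \<in> relation_span S R"
      by (intro add_relation_span B1 B2 d u)
    then show ?thesis
      by (simp add: presented_class_eq_iff frag_extend_diff frag_extend_diff_right frag_extend_minus_fun)
  qed
  show ?thesis
    unfolding presented_bilinear_def
    using eq P1.presented_class_self[of u] P2.presented_class_self[of v] by blast
qed

section \<open>Rings given by a monoid of generators\<close>

lemma abelian_group_if_comm_group:
  assumes "comm_group G" "carrier R = carrier G" "ring.add R = monoid.mult G" "ring.zero R = \<one>\<^bsub>G\<^esub>"
  shows "abelian_group R"
proof -
  interpret comm_group G by fact
  show ?thesis
    by (rule abelian_groupI) (use assms m_assoc m_comm l_inv_ex in \<open>auto\<close>)
qed

text \<open>
  When the generators form a monoid, the free abelian group on them is its integral monoid ring. The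
  last two conditions say that multiplying by a generator preserves the span of the relations, so
  that this span is a two-sided ideal and the presented group inherits a ring structure. The Green
  ring (isomorphism classes under the tensor product) and the scalar extension of a ring (pairs of
  a scalar and a ring element) are both of this form.
\<close>

locale ring_presentation = presentation S R
  for S :: "'a set" and R :: "('a \<Rightarrow>\<^sub>0 int) set" +
  fixes mul :: "'a \<Rightarrow> 'a \<Rightarrow> 'a" and e :: 'a
  assumes mul_closed: "\<lbrakk>x \<in> S; y \<in> S\<rbrakk> \<Longrightarrow> mul x y \<in> S"
    and mul_assoc: "\<lbrakk>x \<in> S; y \<in> S; z \<in> S\<rbrakk> \<Longrightarrow> mul (mul x y) z = mul x (mul y z)"
    and unit_closed: "e \<in> S"
    and mul_unit_left: "x \<in> S \<Longrightarrow> mul e x = x"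
    and mul_unit_right: "x \<in> S \<Longrightarrow> mul x e = x"
    and rel_mul_left:
      "\<lbrakk>x \<in> S; r \<in> R\<rbrakk> \<Longrightarrow> frag_extend (\<lambda>y. frag_of (mul x y)) r \<in> relation_span S R"
    and rel_mul_right:
      "\<lbrakk>x \<in> S; r \<in> R\<rbrakk> \<Longrightarrow> frag_extend (\<lambda>y. frag_of (mul y x)) r \<in> relation_span S R"
begin

definition frag_mult :: "('a \<Rightarrow>\<^sub>0 int) \<Rightarrow> ('a \<Rightarrow>\<^sub>0 int) \<Rightarrow> ('a \<Rightarrow>\<^sub>0 int)" where
  "frag_mult u v = frag_extend (\<lambda>x. frag_extend (\<lambda>y. frag_of (mul x y)) v) u"

lemma frag_mult_simps [simp]:
  "frag_mult 0 v = 0" "frag_mult u 0 = 0"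
  "frag_mult (u - u') v = frag_mult u v - frag_mult u' v"
  "frag_mult u (v - v') = frag_mult u v - frag_mult u v'"
  "frag_mult (frag_of x) (frag_of y) = frag_of (mul x y)"
  by (simp_all add: frag_mult_def frag_extend_diff frag_extend_minus_fun)

lemma frag_mult_add [simp]:
  "frag_mult (u + u') v = frag_mult u v + frag_mult u' v"
  "frag_mult u (v + v') = frag_mult u v + frag_mult u v'"
  by (simp_all add: frag_mult_def frag_extend_add frag_extend_add_fun)

lemma keys_frag_mult:
  "\<lbrakk>Poly_Mapping.keys u \<subseteq> S; Poly_Mapping.keys v \<subseteq> S\<rbrakk> \<Longrightarrow> Poly_Mapping.keys (frag_mult u v) \<subseteq> S"
  unfolding frag_mult_def by (intro keys_frag_extend_subset) (auto simp: mul_closed)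

text \<open>
  The monoid ring laws hold exactly, before passing to the quotient: both sides are additive in each
  argument and agree on generators.
\<close>

lemma frag_mult_assoc:
  assumes "Poly_Mapping.keys u \<subseteq> S" "Poly_Mapping.keys v \<subseteq> S" "Poly_Mapping.keys w \<subseteq> S"
  shows "frag_mult (frag_mult u v) w = frag_mult u (frag_mult v w)"
  using assms(1)
proof (induction u rule: frag_induction)
  case (one x)
  show ?case
    using assms(2)
  proof (induction v rule: frag_induction)
    case (one y)
    show ?case
      using assms(3) by (induction w rule: frag_induction) (simp_all add: mul_assoc one \<open>x \<in> S\<close>)
  qed simp_all
qed simp_all

lemma frag_mult_unit:
  assumes "Poly_Mapping.keys u \<subseteq> S"
  shows "frag_mult (frag_of e) u = u" "frag_mult u (frag_of e) = u"
  using assms by (induction u rule: frag_induction) (simp_all add: mul_unit_left mul_unit_right)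

lemma presented_bilinear_frag_mult:
  assumes "Poly_Mapping.keys u \<subseteq> S" "Poly_Mapping.keys v \<subseteq> S"
  shows "presented_bilinear S R (\<lambda>x y. frag_of (mul x y)) (presented_class S R u) (presented_class S R v) =
         presented_class S R (frag_mult u v)"
  unfolding frag_mult_def
  using presentation_axioms presentation_axioms assms
  by (rule presented_bilinear_class) (auto intro: rel_mul_left rel_mul_right)

theorem ring_presented_group:
  "ring \<lparr>carrier = carrier (presented_group S R),
         monoid.mult = presented_bilinear S R (\<lambda>x y. frag_of (mul x y)),
         one = presented_class S R (frag_of e),
         ring.zero = \<one>\<^bsub>presented_group S R\<^esub>,
         ring.add = monoid.mult (presented_group S R), \<dots> = m\<rparr>" (is "ring ?A")
proof (rule ringI)
  show "abelian_group ?A"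
    by (rule abelian_group_if_comm_group[OF comm_group_presented_group]) simp_all
  show "monoid ?A"
    by (rule monoidI)
      (auto elim!: presented_group_cases
        simp: presented_bilinear_frag_mult keys_frag_mult presented_class_closed frag_mult_assoc frag_mult_unit unit_closed)
qed (auto elim!: presented_group_cases
    simp: presented_bilinear_frag_mult keys_frag_mult mult_presented_group keys_add_subset)

end

section \<open>Unital algebras as linear categories with one object\<close>

text \<open>
  Multiplication need not be commutative: a tensor product is not symmetric in general.
\<close>

locale unital_algebra = M: module K A + A: ring A
  for K :: "('k, 'e) ring_scheme" and A :: "('k, 'a, 'z) module_scheme" +
  assumes smult_mult_left:
      "\<lbrakk>c \<in> carrier K; x \<in> carrier A; y \<in> carrier A\<rbrakk>
        \<Longrightarrow> (c \<odot>\<^bsub>A\<^esub> x) \<otimes>\<^bsub>A\<^esub> y = c \<odot>\<^bsub>A\<^esub> (x \<otimes>\<^bsub>A\<^esub> y)"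
    and smult_mult_right:
      "\<lbrakk>c \<in> carrier K; x \<in> carrier A; y \<in> carrier A\<rbrakk>
        \<Longrightarrow> x \<otimes>\<^bsub>A\<^esub> (c \<odot>\<^bsub>A\<^esub> y) = c \<odot>\<^bsub>A\<^esub> (x \<otimes>\<^bsub>A\<^esub> y)"

text \<open>
  A category with one object whose endomorphisms are identified by \<open>\<phi>\<close> with the elements of a unital
  algebra. Closure under the operations is required because they are total functions, constrained
  by the other conditions only after applying \<open>\<phi>\<close>.
\<close>

locale one_object_presentation = unital_algebra K A
  for K :: "('k, 'e) ring_scheme" and A :: "('k, 'a, 'z) module_scheme" +
  fixes D :: "('o, 'm, 'k, 'y) linear_data_scheme" and i :: 'o and \<phi> :: "'m \<Rightarrow> 'a"
  assumes obj: "Obj D = {i}"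
    and bij: "bij_betw \<phi> (Hom D i i) (carrier A)"
    and comp: "\<lbrakk>f \<in> Hom D i i; g \<in> Hom D i i\<rbrakk> \<Longrightarrow> g \<cdot>\<^bsub>D\<^esub> f \<in> Hom D i i \<and> \<phi> (g \<cdot>\<^bsub>D\<^esub> f) = \<phi> g \<otimes>\<^bsub>A\<^esub> \<phi> f"
    and ident: "Ident D i \<in> Hom D i i \<and> \<phi> (Ident D i) = \<one>\<^bsub>A\<^esub>"
    and add: "\<lbrakk>f \<in> Hom D i i; g \<in> Hom D i i\<rbrakk> \<Longrightarrow> f \<boxplus>\<^bsub>D\<^esub> g \<in> Hom D i i \<and> \<phi> (f \<boxplus>\<^bsub>D\<^esub> g) = \<phi> f \<oplus>\<^bsub>A\<^esub> \<phi> g"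
    and zero: "Zero D i i \<in> Hom D i i \<and> \<phi> (Zero D i i) = \<zero>\<^bsub>A\<^esub>"
    and scal: "\<lbrakk>c \<in> carrier K; f \<in> Hom D i i\<rbrakk> \<Longrightarrow> Scal D c f \<in> Hom D i i \<and> \<phi> (Scal D c f) = c \<odot>\<^bsub>A\<^esub> \<phi> f"
begin

lemma hom_eqI: "\<lbrakk>\<phi> f = \<phi> g; f \<in> Hom D i i; g \<in> Hom D i i\<rbrakk> \<Longrightarrow> f = g"
  using bij by (auto simp: bij_betw_def inj_on_def)

lemma hom_closed: "f \<in> Hom D i i \<Longrightarrow> \<phi> f \<in> carrier A"
  using bij by (auto simp: bij_betw_def)

lemmas transport = obj comp ident add zero scal hom_closed

lemma comm_group_hom: "comm_group (hom_group D i i)"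
proof (rule comm_groupI)
  fix f assume "f \<in> carrier (hom_group D i i)"
  then have f: "f \<in> Hom D i i" by (simp add: hom_group_def)
  then obtain a where a: "a \<in> carrier A" "a \<oplus>\<^bsub>A\<^esub> \<phi> f = \<zero>\<^bsub>A\<^esub>"
    using abelian_groupE(6)[OF M.M.abelian_group_axioms, OF hom_closed] by blast
  then have "a \<in> \<phi> ` Hom D i i"
    using bij_betw_imp_surj_on[OF bij] by simp
  then obtain g where g: "g \<in> Hom D i i" "\<phi> g = a"
    by (elim imageE) simp
  have "g \<boxplus>\<^bsub>D\<^esub> f = Zero D i i"
    by (intro hom_eqI) (simp_all add: f g a transport)
  then show "\<exists>g \<in> carrier (hom_group D i i). g \<otimes>\<^bsub>hom_group D i i\<^esub> f = \<one>\<^bsub>hom_group D i i\<^esub>"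
    using g by (auto simp: hom_group_def)
qed (auto simp: hom_group_def transport M.a_ac intro!: hom_eqI)

lemma module_hom: "module K (hom_module D i i)"
proof (rule moduleI)
  show "cring K" by (rule M.is_cring)
  show "abelian_group (hom_module D i i)"
    by (rule abelian_group_if_comm_group[OF comm_group_hom])
      (simp_all add: hom_module_def hom_group_def)
qed (auto simp: hom_module_def transport M.smult_l_distr M.smult_r_distr M.smult_assoc1 intro!: hom_eqI)

text \<open>
  The equational laws of a linear category hold after applying the injective \<open>\<phi>\<close>
  to both sides, where they become laws of the algebra.
\<close>

lemma linear_category: "linear_category K D"
proof (intro linear_category.intro preadditive_category.intro category.intro
    preadditive_category_axioms.intro linear_category_axioms.intro)
  show "comm_group (hom_group D X Y)" if "X \<in> Obj D" "Y \<in> Obj D" for X Y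
    using that comm_group_hom by (simp add: obj)
  show "module K (hom_module D X Y)" if "X \<in> Obj D" "Y \<in> Obj D" for X Y
    using that module_hom by (simp add: obj)
qed (auto simp: transport A.m_assoc A.l_distr A.r_distr smult_mult_left smult_mult_right intro!: hom_eqI)

end

lemma (in unital_algebra) one_object_presentation_id:
  "one_object_presentation K A (one_object_category A) () (\<lambda>x. x)"
  by (intro one_object_presentation.intro unital_algebra_axioms one_object_presentation_axioms.intro)
    (simp_all add: one_object_category_def bij_betw_def)

lemma (in unital_algebra) linear_category_one_object: "linear_category K (one_object_category A)"
  using one_object_presentation_id by (rule one_object_presentation.linear_category)

lemma (in one_object_presentation) linear_isomorphic_one_object:
  "linear_isomorphic K D (one_object_category A)"
proof -
  interpret D: linear_category K D by (rule linear_category)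
  interpret E: linear_category K "one_object_category A" by (rule linear_category_one_object)
  define \<psi> where "\<psi> = inv_into (Hom D i i) \<phi>"
  have \<psi>: "\<psi> a \<in> Hom D i i" "\<phi> (\<psi> a) = a" if "a \<in> carrier A" for a
    using that bij by (auto simp: \<psi>_def bij_betw_def inv_into_into f_inv_into_f)
  have \<psi>\<phi>: "\<psi> (\<phi> f) = f" if "f \<in> Hom D i i" for f
    using that bij by (auto simp: \<psi>_def bij_betw_def)
  have "linear_functor K D (one_object_category A) (\<lambda>_. ()) \<phi>"
    by unfold_locales (auto simp: one_object_category_def transport)
  moreover have "linear_functor K (one_object_category A) D (\<lambda>_. i) \<psi>"
    by unfold_locales (auto simp: one_object_category_def transport \<psi> intro!: hom_eqI)
  ultimately show ?thesis
    unfolding linear_isomorphic_def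
    by (intro exI[of _ "\<lambda>_. ()"] exI[of _ "\<lambda>_. i"] exI[of _ \<phi>] exI[of _ \<psi>])
      (auto simp: one_object_category_def obj \<psi> \<psi>\<phi>)
qed

section \<open>Scalar extensions of rings\<close>

text \<open>
  A pair of additive maps sends the biadditivity relations to biadditivity relations. Multiplication
  by a generator on either side, multiplication by a scalar, and the map induced by a ring
  homomorphism all have this shape, so this one fact makes all of them well defined.
\<close>

lemma frag_extend_tensor_rel:
  assumes "r \<in> tensor_rels K (add_monoid R)"
    and "\<And>k. k \<in> carrier K \<Longrightarrow> f k \<in> carrier K"
    and "\<And>k l. \<lbrakk>k \<in> carrier K; l \<in> carrier K\<rbrakk> \<Longrightarrow> f (k \<oplus>\<^bsub>K\<^esub> l) = f k \<oplus>\<^bsub>K\<^esub> f l"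
    and "\<And>a. a \<in> carrier R \<Longrightarrow> g a \<in> carrier R'"
    and "\<And>a b. \<lbrakk>a \<in> carrier R; b \<in> carrier R\<rbrakk> \<Longrightarrow> g (a \<oplus>\<^bsub>R\<^esub> b) = g a \<oplus>\<^bsub>R'\<^esub> g b"
  shows "frag_extend (\<lambda>(k, a). frag_of (f k, g a)) r \<in> tensor_rels K (add_monoid R')"
proof -
  consider
    (left) k l a where "k \<in> carrier K" "l \<in> carrier K" "a \<in> carrier R"
      "r = frag_of (k \<oplus>\<^bsub>K\<^esub> l, a) - frag_of (k, a) - frag_of (l, a)"
  | (right) k a b where "k \<in> carrier K" "a \<in> carrier R" "b \<in> carrier R"
      "r = frag_of (k, a \<oplus>\<^bsub>R\<^esub> b) - frag_of (k, a) - frag_of (k, b)"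
    using assms(1) unfolding tensor_rels_def by auto
  then show ?thesis
  proof cases
    case left
    then have "frag_extend (\<lambda>(k, a). frag_of (f k, g a)) r
        = frag_of (f k \<oplus>\<^bsub>K\<^esub> f l, g a) - frag_of (f k, g a) - frag_of (f l, g a)"
      by (simp add: frag_extend_diff assms)
    moreover have "f k \<in> carrier K" "f l \<in> carrier K" "g a \<in> carrier R'"
      using left assms by auto
    ultimately show ?thesis unfolding tensor_rels_def by auto
  next
    case right
    then have "frag_extend (\<lambda>(k, a). frag_of (f k, g a)) r
        = frag_of (f k, g a \<oplus>\<^bsub>R'\<^esub> g b) - frag_of (f k, g a) - frag_of (f k, g b)"
      by (simp add: frag_extend_diff assms)
    moreover have "f k \<in> carrier K" "g a \<in> carrier R'" "g b \<in> carrier R'"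
      using right assms by auto
    ultimately show ?thesis unfolding tensor_rels_def by auto
  qed
qed

locale scalar_extension = K: cring K + R: ring R
  for K :: "('k, 'e) ring_scheme" and R :: "('a, 'f) ring_scheme"
begin

abbreviation gens :: "('k \<times> 'a) set" where
  "gens \<equiv> carrier K \<times> carrier R"

abbreviation rels :: "('k \<times> 'a \<Rightarrow>\<^sub>0 int) set" where
  "rels \<equiv> tensor_rels K (add_monoid R)"

abbreviation ext :: "('k, ('k \<times> 'a \<Rightarrow>\<^sub>0 int) set) module" where
  "ext \<equiv> scalar_extension_algebra K R"

abbreviation gen_mult :: "'k \<times> 'a \<Rightarrow> 'k \<times> 'a \<Rightarrow> 'k \<times> 'a" where
  "gen_mult \<equiv> (\<lambda>(k, a) (l, b). (k \<otimes>\<^bsub>K\<^esub> l, a \<otimes>\<^bsub>R\<^esub> b))"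

abbreviation gen_smult :: "'k \<Rightarrow> 'k \<times> 'a \<Rightarrow> ('k \<times> 'a \<Rightarrow>\<^sub>0 int)" where
  "gen_smult c \<equiv> (\<lambda>(k, a). frag_of (c \<otimes>\<^bsub>K\<^esub> k, a))"

sublocale ring_presentation gens rels gen_mult "(\<one>\<^bsub>K\<^esub>, \<one>\<^bsub>R\<^esub>)"
proof (intro ring_presentation.intro presentation.intro ring_presentation_axioms.intro)
  show "Poly_Mapping.keys r \<subseteq> gens" if "r \<in> rels" for r
    using that unfolding tensor_rels_def 
    by (elim UnE CollectE exE conjE) (simp_all add: keys_diff_subset)
  show "frag_extend (\<lambda>y. frag_of (gen_mult x y)) r \<in> relation_span gens rels"
    if x: "x \<in> gens" and r: "r \<in> rels" for x r
  proof -
    obtain k a where "x = (k, a)" "k \<in> carrier K" "a \<in> carrier R"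
      using x by auto
    then show ?thesis
      using frag_extend_tensor_rel[OF r, of "\<lambda>l. k \<otimes>\<^bsub>K\<^esub> l" "\<lambda>b. a \<otimes>\<^bsub>R\<^esub> b" R]
      by (auto simp: K.r_distr R.r_distr case_prod_beta' intro!: generate.incl)
  qed
  show "frag_extend (\<lambda>y. frag_of (gen_mult y x)) r \<in> relation_span gens rels"
    if x: "x \<in> gens" and r: "r \<in> rels" for x r
  proof -
    obtain k a where "x = (k, a)" "k \<in> carrier K" "a \<in> carrier R"
      using x by auto
    then show ?thesis
      using frag_extend_tensor_rel[OF r, of "\<lambda>l. l \<otimes>\<^bsub>K\<^esub> k" "\<lambda>b. b \<otimes>\<^bsub>R\<^esub> a" R]
      by (auto simp: K.l_distr R.l_distr case_prod_beta' intro!: generate.incl)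
  qed
qed (auto simp: K.m_assoc R.m_assoc)

lemma ext_simps:
  "carrier ext = carrier (presented_group gens rels)"
  "monoid.mult ext = presented_bilinear gens rels (\<lambda>x y. frag_of (gen_mult x y))"
  "\<one>\<^bsub>ext\<^esub> = presented_class gens rels (frag_of (\<one>\<^bsub>K\<^esub>, \<one>\<^bsub>R\<^esub>))"
  "\<zero>\<^bsub>ext\<^esub> = \<one>\<^bsub>presented_group gens rels\<^esub>"
  "ring.add ext = monoid.mult (presented_group gens rels)"
  "module.smult ext c = presented_linear gens rels (gen_smult c)"
  by (simp_all add: scalar_extension_algebra_def tensor_mult_def tensor_smult_def pure_tensor_def
      tensor_group_def Let_def case_prod_beta')

lemma ext_cases:
  assumes "s \<in> carrier ext"
  obtains u where "Poly_Mapping.keys u \<subseteq> gens" "s = presented_class gens rels u"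
  using assms by (auto simp: ext_simps elim: presented_group_cases)

lemma ring_ext: "ring ext"
  unfolding scalar_extension_algebra_def tensor_mult_def tensor_smult_def pure_tensor_def
    tensor_group_def Let_def
  using ring_presented_group[where m = "\<lparr>smult = \<lambda>c. presented_linear gens rels (gen_smult c)\<rparr>"]
  by (simp add: case_prod_beta')

lemma smult_class:
  assumes "c \<in> carrier K" "Poly_Mapping.keys u \<subseteq> gens"
  shows "c \<odot>\<^bsub>ext\<^esub> presented_class gens rels u = presented_class gens rels (frag_extend (gen_smult c) u)"
  unfolding ext_simps
  using presentation_axioms assms(2)
proof (rule presented_linear_class)
  show "frag_extend (gen_smult c) r \<in> relation_span gens rels" if "r \<in> rels" for r
    using frag_extend_tensor_rel[OF that, of "\<lambda>k. c \<otimes>\<^bsub>K\<^esub> k" "\<lambda>a. a" R] assms(1)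
    by (auto simp: K.r_distr intro: generate.incl)
qed

lemma keys_gen_smult:
  "\<lbrakk>c \<in> carrier K; Poly_Mapping.keys u \<subseteq> gens\<rbrakk>
    \<Longrightarrow> Poly_Mapping.keys (frag_extend (gen_smult c) u) \<subseteq> gens"
  by (rule keys_frag_extend_subset) auto

lemma mult_class:
  "\<lbrakk>Poly_Mapping.keys u \<subseteq> gens; Poly_Mapping.keys v \<subseteq> gens\<rbrakk> \<Longrightarrow>
    presented_class gens rels u \<otimes>\<^bsub>ext\<^esub> presented_class gens rels v
      = presented_class gens rels (frag_mult u v)"
  by (simp add: ext_simps presented_bilinear_frag_mult)

lemma add_class:
  "\<lbrakk>Poly_Mapping.keys u \<subseteq> gens; Poly_Mapping.keys v \<subseteq> gens\<rbrakk> \<Longrightarrow>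
    presented_class gens rels u \<oplus>\<^bsub>ext\<^esub> presented_class gens rels v = presented_class gens rels (u + v)"
  by (simp add: ext_simps mult_presented_group)

lemma class_closed: "Poly_Mapping.keys u \<subseteq> gens \<Longrightarrow> presented_class gens rels u \<in> carrier ext"
  by (auto simp: ext_simps)

text \<open>
  The only module law that needs the relations: the two sides differ on the generator \<open>(k, a)\<close> by the
  relation expressing additivity in the scalar. The other laws hold on representatives.
\<close>

lemma gen_smult_add:
  assumes c: "c \<in> carrier K" "d \<in> carrier K" and u: "Poly_Mapping.keys u \<subseteq> gens"
  shows "frag_extend (gen_smult (c \<oplus>\<^bsub>K\<^esub> d)) u - (frag_extend (gen_smult c) u + frag_extend (gen_smult d) u)
    \<in> relation_span gens rels"
  using u
proof (induction u rule: frag_induction)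
  case zero then show ?case by (simp add: zero_relation_span)
next
  case (one x)
  then obtain k a where x: "x = (k, a)" "k \<in> carrier K" "a \<in> carrier R" by auto
  then have "frag_of (c \<otimes>\<^bsub>K\<^esub> k \<oplus>\<^bsub>K\<^esub> d \<otimes>\<^bsub>K\<^esub> k, a) - frag_of (c \<otimes>\<^bsub>K\<^esub> k, a) - frag_of (d \<otimes>\<^bsub>K\<^esub> k, a) \<in> rels"
    using c unfolding tensor_rels_def by auto
  then show ?case
    using x c by (auto simp: K.l_distr diff_diff_eq intro: generate.incl)
next
  case (diff u v)
  then show ?case
    using diff_relation_span[OF diff] by (simp add: frag_extend_diff algebra_simps)
qed

lemma gen_smult_assoc:
  assumes "c \<in> carrier K" "d \<in> carrier K" "Poly_Mapping.keys u \<subseteq> gens"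
  shows "frag_extend (gen_smult (c \<otimes>\<^bsub>K\<^esub> d)) u = frag_extend (gen_smult c) (frag_extend (gen_smult d) u)"
  using assms(3) by (induction u rule: frag_induction)
    (use assms(1,2) in \<open>auto simp: frag_extend_diff K.m_assoc\<close>)

lemma gen_smult_one:
  assumes "Poly_Mapping.keys u \<subseteq> gens"
  shows "frag_extend (gen_smult \<one>\<^bsub>K\<^esub>) u = u"
  using assms by (induction u rule: frag_induction) (auto simp: frag_extend_diff)

lemma gen_smult_frag_mult:
  assumes c: "c \<in> carrier K" and u: "Poly_Mapping.keys u \<subseteq> gens" and v: "Poly_Mapping.keys v \<subseteq> gens"
  shows "frag_mult (frag_extend (gen_smult c) u) v = frag_extend (gen_smult c) (frag_mult u v)"
    and "frag_mult u (frag_extend (gen_smult c) v) = frag_extend (gen_smult c) (frag_mult u v)"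
proof -
  have gen: "frag_mult (gen_smult c x) (frag_of y) = gen_smult c (gen_mult x y)"
    "frag_mult (frag_of x) (gen_smult c y) = gen_smult c (gen_mult x y)"
    if "x \<in> gens" "y \<in> gens" for x y
    using that c by (auto simp: K.m_assoc K.m_lcomm)
  have left: "frag_mult (gen_smult c x) v = frag_extend (gen_smult c) (frag_mult (frag_of x) v)"
    "frag_mult (frag_of x) (frag_extend (gen_smult c) v) = frag_extend (gen_smult c) (frag_mult (frag_of x) v)"
    if "x \<in> gens" for x
    using v by (induction v rule: frag_induction) (simp_all add: frag_extend_diff gen that)
  show "frag_mult (frag_extend (gen_smult c) u) v = frag_extend (gen_smult c) (frag_mult u v)"
    using u by (induction u rule: frag_induction) (simp_all add: frag_extend_diff left)
  show "frag_mult u (frag_extend (gen_smult c) v) = frag_extend (gen_smult c) (frag_mult u v)"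
    using u by (induction u rule: frag_induction) (simp_all add: frag_extend_diff left)
qed

lemmas class_simps = smult_class mult_class add_class class_closed keys_gen_smult keys_frag_mult
  keys_add_subset

theorem unital_algebra_ext: "unital_algebra K ext"
proof (intro unital_algebra.intro unital_algebra_axioms.intro ring_ext moduleI)
  show "cring K" by (rule K.is_cring)
  show "abelian_group ext" using ring_ext by (rule ring.is_abelian_group)
  show "(c \<oplus>\<^bsub>K\<^esub> d) \<odot>\<^bsub>ext\<^esub> s = c \<odot>\<^bsub>ext\<^esub> s \<oplus>\<^bsub>ext\<^esub> d \<odot>\<^bsub>ext\<^esub> s"
    if "c \<in> carrier K" "d \<in> carrier K" "s \<in> carrier ext" for c d s
    using that(3)
  proof (rule ext_cases)
    fix u assume "Poly_Mapping.keys u \<subseteq> gens" "s = presented_class gens rels u"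
    then show ?thesis
      using that(1,2) gen_smult_add by (simp add: class_simps presented_class_eq_iff)
  qed
qed (auto elim!: ext_cases simp: class_simps frag_extend_add gen_smult_assoc gen_smult_one
    gen_smult_frag_mult)

end

section \<open>Functoriality of scalar extension\<close>

definition scalar_extension_map ::
    "('k, 'e) ring_scheme \<Rightarrow> ('b, 'f) ring_scheme \<Rightarrow> ('a \<Rightarrow> 'b)
      \<Rightarrow> ('k \<times> 'a \<Rightarrow>\<^sub>0 int) set \<Rightarrow> ('k \<times> 'b \<Rightarrow>\<^sub>0 int) set" where
  "scalar_extension_map K R h =
    presented_linear (carrier K \<times> carrier R) (tensor_rels K (add_monoid R)) (\<lambda>(k, a). frag_of (k, h a))"

locale scalar_extension_hom = D: scalar_extension K Q + E: scalar_extension K R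
  for K :: "('k, 'e) ring_scheme" and Q :: "('a, 'f) ring_scheme" and R :: "('b, 'g) ring_scheme" +
  fixes h :: "'a \<Rightarrow> 'b"
  assumes hom: "h \<in> ring_hom Q R"
begin

abbreviation gen_map :: "'k \<times> 'a \<Rightarrow> ('k \<times> 'b \<Rightarrow>\<^sub>0 int)" where
  "gen_map \<equiv> (\<lambda>(k, a). frag_of (k, h a))"

lemma map_class:
  assumes "Poly_Mapping.keys u \<subseteq> D.gens"
  shows "scalar_extension_map K R h (presented_class D.gens D.rels u)
    = presented_class E.gens E.rels (frag_extend gen_map u)"
  unfolding scalar_extension_map_def using D.presentation_axioms assms
proof (rule E.presented_linear_class)
  show "frag_extend gen_map r \<in> relation_span E.gens E.rels" if "r \<in> D.rels" for r
    using frag_extend_tensor_rel[OF that, of "\<lambda>k. k" h R] hom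
    by (auto simp: ring_hom_closed ring_hom_add intro: generate.incl)
qed

lemma keys_gen_map:
  "Poly_Mapping.keys u \<subseteq> D.gens \<Longrightarrow> Poly_Mapping.keys (frag_extend gen_map u) \<subseteq> E.gens"
  by (rule keys_frag_extend_subset) (auto simp: ring_hom_closed[OF hom])

lemma gen_map_frag_mult:
  assumes u: "Poly_Mapping.keys u \<subseteq> D.gens" and v: "Poly_Mapping.keys v \<subseteq> D.gens"
  shows "frag_extend gen_map (D.frag_mult u v) = E.frag_mult (frag_extend gen_map u) (frag_extend gen_map v)"
  using u
proof (induction u rule: frag_induction)
  case (one x)
  show ?case
    using v
    by (induction v rule: frag_induction)
      (use one in \<open>auto simp: frag_extend_diff ring_hom_mult[OF hom]\<close>)
qed (simp_all add: frag_extend_diff)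

lemma gen_map_gen_smult:
  assumes "Poly_Mapping.keys u \<subseteq> D.gens"
  shows "frag_extend gen_map (frag_extend (D.gen_smult c) u) = frag_extend (E.gen_smult c) (frag_extend gen_map u)"
  using assms by (induction u rule: frag_induction) (auto simp: frag_extend_diff)

lemma map_closed: "s \<in> carrier D.ext \<Longrightarrow> scalar_extension_map K R h s \<in> carrier E.ext"
  by (auto elim!: D.ext_cases simp: map_class keys_gen_map E.class_closed)

lemma map_mult:
  "\<lbrakk>s \<in> carrier D.ext; t \<in> carrier D.ext\<rbrakk> \<Longrightarrow> scalar_extension_map K R h (s \<otimes>\<^bsub>D.ext\<^esub> t)
    = scalar_extension_map K R h s \<otimes>\<^bsub>E.ext\<^esub> scalar_extension_map K R h t"
  by (auto elim!: D.ext_cases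
      simp: D.mult_class E.mult_class map_class keys_gen_map gen_map_frag_mult D.keys_frag_mult)

lemma map_add:
  "\<lbrakk>s \<in> carrier D.ext; t \<in> carrier D.ext\<rbrakk> \<Longrightarrow> scalar_extension_map K R h (s \<oplus>\<^bsub>D.ext\<^esub> t)
    = scalar_extension_map K R h s \<oplus>\<^bsub>E.ext\<^esub> scalar_extension_map K R h t"
  by (auto elim!: D.ext_cases
      simp: D.add_class E.add_class map_class keys_gen_map keys_add_subset frag_extend_add)

lemma map_smult:
  "\<lbrakk>c \<in> carrier K; s \<in> carrier D.ext\<rbrakk> \<Longrightarrow> scalar_extension_map K R h (c \<odot>\<^bsub>D.ext\<^esub> s)
    = c \<odot>\<^bsub>E.ext\<^esub> scalar_extension_map K R h s"
  by (auto elim!: D.ext_cases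
      simp: D.smult_class E.smult_class map_class keys_gen_map D.keys_gen_smult gen_map_gen_smult)

lemma map_one: "scalar_extension_map K R h \<one>\<^bsub>D.ext\<^esub> = \<one>\<^bsub>E.ext\<^esub>"
  by (simp add: D.ext_simps E.ext_simps map_class ring_hom_one[OF hom])

lemma map_zero: "scalar_extension_map K R h \<zero>\<^bsub>D.ext\<^esub> = \<zero>\<^bsub>E.ext\<^esub>"
  by (simp add: D.ext_simps E.ext_simps D.one_presented_group E.one_presented_group map_class)

end

lemma scalar_extension_map_inverse:
  assumes "scalar_extension_hom K Q R h" "scalar_extension_hom K R Q g"
    and gh: "\<And>a. a \<in> carrier Q \<Longrightarrow> g (h a) = a"
    and s: "s \<in> carrier (scalar_extension_algebra K Q)"
  shows "scalar_extension_map K Q g (scalar_extension_map K R h s) = s"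
proof -
  interpret H: scalar_extension_hom K Q R h by fact
  interpret G: scalar_extension_hom K R Q g by fact
  obtain u where u: "Poly_Mapping.keys u \<subseteq> H.D.gens" "s = presented_class H.D.gens H.D.rels u"
    using s by (rule H.D.ext_cases)
  have "frag_extend G.gen_map (frag_extend H.gen_map u) = u"
    using u(1) by (induction u rule: frag_induction) (auto simp: frag_extend_diff gh)
  then show ?thesis
    using u by (simp add: H.map_class G.map_class H.keys_gen_map)
qed

text \<open>
  The inverse is the map induced by the inverse of \<open>h\<close>, since induced maps compose on generators.
\<close>

lemma bij_betw_scalar_extension_map:
  assumes K: "cring K" and Q: "ring Q" and R: "ring R" and h: "h \<in> ring_iso Q R"
  shows "bij_betw (scalar_extension_map K R h)
    (carrier (scalar_extension_algebra K Q)) (carrier (scalar_extension_algebra K R))"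
proof -
  define g where "g = inv_into (carrier Q) h"
  have bij: "bij_betw h (carrier Q) (carrier R)" using h by (rule ring_iso_memE)
  have g: "g \<in> ring_iso R Q"
    unfolding g_def using Q h by (rule ring_iso_set_sym)
  have H: "scalar_extension_hom K Q R h" and G: "scalar_extension_hom K R Q g"
    using assms g
    by (auto intro!: scalar_extension_hom.intro scalar_extension.intro scalar_extension_hom_axioms.intro
        simp: ring_iso_def)
  have "g (h a) = a" if "a \<in> carrier Q" for a
    unfolding g_def using bij that by (simp add: bij_betw_inv_into_left)
  moreover have "h (g b) = b" if "b \<in> carrier R" for b
    unfolding g_def using bij that by (simp add: bij_betw_inv_into_right)
  ultimately show ?thesis
    by (intro bij_betw_byWitness[where f' = "scalar_extension_map K Q g"] ballI
        scalar_extension_map_inverse[OF H G] scalar_extension_map_inverse[OF G H] image_subsetI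
        scalar_extension_hom.map_closed[OF H] scalar_extension_hom.map_closed[OF G])
qed

lemma add_monoid_End_ring: "add_monoid (End_ring P i) = hom_group P i i"
  by (simp add: End_ring_def hom_group_def)

text \<open>
  In a category with one object the hom-group is the additive group of the endomorphism ring, and
  composition is its multiplication. Extending the scalars of the category therefore amounts to
  extending those of the endomorphism ring, up to the tags on morphisms, and the latter extension
  depends only on the isomorphism class of the ring.
\<close>

theorem one_object_presentation_scalar_extension_category:
  assumes K: "cring K" and R: "ring R" and P: "ring (End_ring P i)"
    and obj: "Obj P = {i}" and h: "h \<in> ring_iso (End_ring P i) R"
  shows "one_object_presentation K (scalar_extension_algebra K R) (scalar_extension_category K P) i
    (\<lambda>(_, _, s). scalar_extension_map K R h s)"
proof -
  interpret E: scalar_extension K R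
    using K R by (rule scalar_extension.intro)
  interpret H: scalar_extension_hom K "End_ring P i" R h
    using K R P h
    by (intro scalar_extension_hom.intro scalar_extension.intro scalar_extension_hom_axioms.intro)
      (simp_all add: ring_iso_def)
  note D_closed =
    monoid.m_closed[OF ring.is_monoid[OF H.D.ring_ext]] monoid.one_closed[OF ring.is_monoid[OF H.D.ring_ext]]
    ring.ring_simprules(1,2)[OF H.D.ring_ext]
    module.smult_closed[OF unital_algebra.axioms(1)[OF H.D.unital_algebra_ext]]
  let ?C = "scalar_extension_category K P"
  have cat: "Obj ?C = {i}" "Hom ?C i i = (\<lambda>s. (i, i, s)) ` carrier H.D.ext"
    "Comp ?C (i, i, s) (i, i, t) = (i, i, s \<otimes>\<^bsub>H.D.ext\<^esub> t)"
    "Ident ?C i = (i, i, \<one>\<^bsub>H.D.ext\<^esub>)"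
    "Add ?C (i, i, s) (i, i, t) = (i, i, s \<oplus>\<^bsub>H.D.ext\<^esub> t)"
    "Zero ?C i i = (i, i, \<zero>\<^bsub>H.D.ext\<^esub>)"
    "Scal ?C c (i, i, s) = (i, i, c \<odot>\<^bsub>H.D.ext\<^esub> s)" for s t c
    unfolding scalar_extension_category_def scalar_extension_algebra_def add_monoid_End_ring Let_def
    by (simp_all add: obj Setcompr_eq_image) (simp_all add: End_ring_def)
  have "bij_betw (\<lambda>(_, _, s). scalar_extension_map K R h s) (Hom ?C i i) (carrier E.ext)"
    using bij_betw_scalar_extension_map[OF K P R h]
    by (auto simp: cat bij_betw_def inj_on_def image_image)
  then show ?thesis
    by (intro one_object_presentation.intro E.unital_algebra_ext one_object_presentation_axioms.intro)
      (auto simp: cat H.map_mult H.map_add H.map_smult H.map_one H.map_zero D_closed)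
qed

section \<open>The Green ring is a ring\<close>

context category
begin

lemma iso_morI:
  "\<lbrakk>f \<in> Hom C X Y; g \<in> Hom C Y X; g \<cdot> f = Ident C X; f \<cdot> g = Ident C Y\<rbrakk> \<Longrightarrow> iso_mor C f X Y"
  unfolding iso_mor_def by blast

lemma isomorphic_refl: "X \<in> Obj C \<Longrightarrow> isomorphic C X X"
  unfolding isomorphic_def using iso_morI[OF ident_closed ident_closed] ident_left ident_closed by metis

lemma isomorphic_sym: "isomorphic C X Y \<Longrightarrow> isomorphic C Y X"
  unfolding isomorphic_def iso_mor_def by blast

lemma isomorphic_trans:
  assumes "isomorphic C X Y" "isomorphic C Y Z" shows "isomorphic C X Z"
proof -
  have obj: "X \<in> Obj C" "Y \<in> Obj C" "Z \<in> Obj C"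
    using assms by (auto simp: isomorphic_def)
  obtain f f' where f: "f \<in> Hom C X Y" "f' \<in> Hom C Y X" "f' \<cdot> f = Ident C X" "f \<cdot> f' = Ident C Y"
    using assms(1) unfolding isomorphic_def iso_mor_def by blast
  obtain g g' where g: "g \<in> Hom C Y Z" "g' \<in> Hom C Z Y" "g' \<cdot> g = Ident C Y" "g \<cdot> g' = Ident C Z"
    using assms(2) unfolding isomorphic_def iso_mor_def by blast
  have gf: "g \<cdot> f \<in> Hom C X Z" "f' \<cdot> g' \<in> Hom C Z X"
    by (rule comp_closed[of X Y Z] comp_closed[of Z Y X]; use obj f g in simp)+
  have "(f' \<cdot> g') \<cdot> (g \<cdot> f) = f' \<cdot> ((g' \<cdot> g) \<cdot> f)"
    using obj f g gf comp_assoc[of X Z Y X "g \<cdot> f" g' f'] comp_assoc[of X Y Z Y f g g'] by simp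
  moreover have "(g \<cdot> f) \<cdot> (f' \<cdot> g') = g \<cdot> ((f \<cdot> f') \<cdot> g')"
    using obj f g gf comp_assoc[of Z X Y Z "f' \<cdot> g'" f g] comp_assoc[of Z Y X Y g' f' f] by simp
  ultimately have "iso_mor C (g \<cdot> f) X Z"
    using obj f g gf ident_left[of X Y f] ident_left[of Z Y g'] by (intro iso_morI) simp_all
  then show ?thesis
    using obj unfolding isomorphic_def by blast
qed

lemma iso_class_eq_iff:
  assumes "X \<in> Obj C"
  shows "iso_class C X = iso_class C Y \<longleftrightarrow> isomorphic C X Y"
proof
  assume "iso_class C X = iso_class C Y"
  then have "X \<in> iso_class C Y" using isomorphic_refl[OF assms] by (auto simp: iso_class_def)
  then show "isomorphic C X Y" by (auto simp: iso_class_def intro: isomorphic_sym)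
next
  assume "isomorphic C X Y"
  then show "iso_class C X = iso_class C Y"
    unfolding iso_class_def by (auto intro: isomorphic_trans isomorphic_sym)
qed

lemma iso_class_self: "X \<in> Obj C \<Longrightarrow> X \<in> iso_class C X"
  by (simp add: iso_class_def isomorphic_refl)

end

lemma iso_classI: "X \<in> Obj C \<Longrightarrow> iso_class C X \<in> iso_classes C"
  by (simp add: iso_classes_def)

lemma iso_classesE:
  assumes "U \<in> iso_classes C" obtains X where "X \<in> Obj C" "U = iso_class C X"
  using assms by (auto simp: iso_classes_def)

lemma (in bifunctor) isomorphic_tensor:
  assumes "isomorphic A X X'" "isomorphic B Y Y'"
  shows "isomorphic D (Fo X Y) (Fo X' Y')"
proof -
  have obj: "X \<in> Obj A" "X' \<in> Obj A" "Y \<in> Obj B" "Y' \<in> Obj B"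
    using assms by (auto simp: isomorphic_def)
  obtain f f' where f: "f \<in> Hom A X X'" "f' \<in> Hom A X' X"
    "f' \<cdot>\<^bsub>A\<^esub> f = Ident A X" "f \<cdot>\<^bsub>A\<^esub> f' = Ident A X'"
    using assms(1) unfolding isomorphic_def iso_mor_def by blast
  obtain g g' where g: "g \<in> Hom B Y Y'" "g' \<in> Hom B Y' Y"
    "g' \<cdot>\<^bsub>B\<^esub> g = Ident B Y" "g \<cdot>\<^bsub>B\<^esub> g' = Ident B Y'"
    using assms(2) unfolding isomorphic_def iso_mor_def by blast
  have "iso_mor D (Fm f g) (Fo X Y) (Fo X' Y')"
  proof (rule D.iso_morI[of _ _ _ "Fm f' g'"])
    show "Fm f' g' \<cdot>\<^bsub>D\<^esub> Fm f g = Ident D (Fo X Y)"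
      using mor_comp[OF obj(1,2,1) obj(3,4,3) f(1,2) g(1,2)] mor_ident[OF obj(1,3)] f g by simp
    show "Fm f g \<cdot>\<^bsub>D\<^esub> Fm f' g' = Ident D (Fo X' Y')"
      using mor_comp[OF obj(2,1,2) obj(4,3,4) f(2,1) g(2,1)] mor_ident[OF obj(2,4)] f g by simp
  qed (use mor_closed obj f g in auto)
  then show ?thesis
    using obj obj_closed unfolding isomorphic_def by blast
qed

text \<open>
  Used to show that additive functors preserve zero morphisms: the image of zero is its own double.
\<close>

lemma (in preadditive_category) idempotent_sum_zero:
  assumes "X \<in> Obj C" "Y \<in> Obj C" "f \<in> Hom C X Y" "f \<boxplus> f = f"
  shows "f = Zero C X Y"
  using group.l_cancel_one[OF comm_group.axioms(2)[OF hom_comm_group[OF assms(1,2)]], of f f] assms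
  by (simp add: hom_group_def)

lemma (in preadditive_category) zero_closed:
  assumes "X \<in> Obj C" "Y \<in> Obj C" shows "Zero C X Y \<in> Hom C X Y" "Zero C X Y \<boxplus> Zero C X Y = Zero C X Y"
  using comm_groupE(2,5)[OF hom_comm_group[OF assms]] by (auto simp: hom_group_def)

context additive_bifunctor
begin

lemma mor_zero_left:
  assumes "X \<in> Obj A" "X' \<in> Obj A" "Y \<in> Obj B" "Y' \<in> Obj B" "g \<in> Hom B Y Y'"
  shows "Fm (Zero A X X') g = Zero D (Fo X Y) (Fo X' Y')"
  using mor_add_left[of X X' Y Y' "Zero A X X'" "Zero A X X'" g] assms A.zero_closed[of X X']
  by (intro D.idempotent_sum_zero) (simp_all add: obj_closed mor_closed)

lemma mor_zero_right:
  assumes "X \<in> Obj A" "X' \<in> Obj A" "Y \<in> Obj B" "Y' \<in> Obj B" "f \<in> Hom A X X'"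
  shows "Fm f (Zero B Y Y') = Zero D (Fo X Y) (Fo X' Y')"
  using mor_add_right[of X X' Y Y' f "Zero B Y Y'" "Zero B Y Y'"] assms B.zero_closed[of Y Y']
  by (intro D.idempotent_sum_zero) (simp_all add: obj_closed mor_closed)

text \<open>
  Tensoring with a fixed object is an additive functor, and a biproduct is given by morphisms
  subject to equations in composition and addition, which such a functor preserves.
\<close>

lemma direct_sum_tensor_right:
  assumes S: "direct_sum A S X X'" and Y: "Y \<in> Obj B"
  shows "direct_sum D (Fo S Y) (Fo X Y) (Fo X' Y)"
proof -
  obtain i j p q where obj: "S \<in> Obj A" "X \<in> Obj A" "X' \<in> Obj A"
    and hom: "i \<in> Hom A X S" "j \<in> Hom A X' S" "p \<in> Hom A S X" "q \<in> Hom A S X'"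
    and eq: "p \<cdot>\<^bsub>A\<^esub> i = Ident A X" "q \<cdot>\<^bsub>A\<^esub> j = Ident A X'"
      "q \<cdot>\<^bsub>A\<^esub> i = Zero A X X'" "p \<cdot>\<^bsub>A\<^esub> j = Zero A X' X"
      "(i \<cdot>\<^bsub>A\<^esub> p) \<boxplus>\<^bsub>A\<^esub> (j \<cdot>\<^bsub>A\<^esub> q) = Ident A S"
    using S unfolding direct_sum_def by blast
  let ?F = "\<lambda>f. Fm f (Ident B Y)"
  have id: "Ident B Y \<in> Hom B Y Y" using Y by (rule B.ident_closed)
  have comp: "?F g \<cdot>\<^bsub>D\<^esub> ?F f = ?F (g \<cdot>\<^bsub>A\<^esub> f)"
    if "U \<in> Obj A" "V \<in> Obj A" "W \<in> Obj A" "f \<in> Hom A U V" "g \<in> Hom A V W" for U V W f g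
    using mor_comp[OF that(1-3) Y Y Y that(4,5) id id] B.ident_left[OF Y Y id] by simp
  have "i \<cdot>\<^bsub>A\<^esub> p \<in> Hom A S S" "j \<cdot>\<^bsub>A\<^esub> q \<in> Hom A S S"
    using A.comp_closed obj hom by blast+
  then have "?F (i \<cdot>\<^bsub>A\<^esub> p) \<boxplus>\<^bsub>D\<^esub> ?F (j \<cdot>\<^bsub>A\<^esub> q) = Ident D (Fo S Y)"
    using eq(5) mor_ident[OF obj(1) Y] by (simp add: mor_add_left[OF obj(1,1) Y Y _ _ id, symmetric])
  then have "?F p \<cdot>\<^bsub>D\<^esub> ?F i = Ident D (Fo X Y)" "?F q \<cdot>\<^bsub>D\<^esub> ?F j = Ident D (Fo X' Y)"
    "?F q \<cdot>\<^bsub>D\<^esub> ?F i = Zero D (Fo X Y) (Fo X' Y)" "?F p \<cdot>\<^bsub>D\<^esub> ?F j = Zero D (Fo X' Y) (Fo X Y)"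
    "(?F i \<cdot>\<^bsub>D\<^esub> ?F p) \<boxplus>\<^bsub>D\<^esub> (?F j \<cdot>\<^bsub>D\<^esub> ?F q) = Ident D (Fo S Y)"
    using comp obj hom eq mor_ident Y mor_zero_left[OF _ _ Y Y id] by auto
  moreover have "?F i \<in> Hom D (Fo X Y) (Fo S Y)" "?F j \<in> Hom D (Fo X' Y) (Fo S Y)"
    "?F p \<in> Hom D (Fo S Y) (Fo X Y)" "?F q \<in> Hom D (Fo S Y) (Fo X' Y)"
    using mor_closed obj hom Y id by auto
  ultimately show ?thesis
    unfolding direct_sum_def using obj Y obj_closed by blast
qed

lemma direct_sum_tensor_left:
  assumes S: "direct_sum B S Y Y'" and X: "X \<in> Obj A"
  shows "direct_sum D (Fo X S) (Fo X Y) (Fo X Y')"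
proof -
  obtain i j p q where obj: "S \<in> Obj B" "Y \<in> Obj B" "Y' \<in> Obj B"
    and hom: "i \<in> Hom B Y S" "j \<in> Hom B Y' S" "p \<in> Hom B S Y" "q \<in> Hom B S Y'"
    and eq: "p \<cdot>\<^bsub>B\<^esub> i = Ident B Y" "q \<cdot>\<^bsub>B\<^esub> j = Ident B Y'"
      "q \<cdot>\<^bsub>B\<^esub> i = Zero B Y Y'" "p \<cdot>\<^bsub>B\<^esub> j = Zero B Y' Y"
      "(i \<cdot>\<^bsub>B\<^esub> p) \<boxplus>\<^bsub>B\<^esub> (j \<cdot>\<^bsub>B\<^esub> q) = Ident B S"
    using S unfolding direct_sum_def by blast
  let ?F = "\<lambda>f. Fm (Ident A X) f"
  have id: "Ident A X \<in> Hom A X X" using X by (rule A.ident_closed)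
  have comp: "?F g \<cdot>\<^bsub>D\<^esub> ?F f = ?F (g \<cdot>\<^bsub>B\<^esub> f)"
    if "U \<in> Obj B" "V \<in> Obj B" "W \<in> Obj B" "f \<in> Hom B U V" "g \<in> Hom B V W" for U V W f g
    using mor_comp[OF X X X that(1-3) id id that(4,5)] A.ident_left[OF X X id] by simp
  have "i \<cdot>\<^bsub>B\<^esub> p \<in> Hom B S S" "j \<cdot>\<^bsub>B\<^esub> q \<in> Hom B S S"
    using B.comp_closed obj hom by blast+
  then have "?F (i \<cdot>\<^bsub>B\<^esub> p) \<boxplus>\<^bsub>D\<^esub> ?F (j \<cdot>\<^bsub>B\<^esub> q) = Ident D (Fo X S)"
    using eq(5) mor_ident[OF X obj(1)] by (simp add: mor_add_right[OF X X obj(1,1) id, symmetric])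
  then have "?F p \<cdot>\<^bsub>D\<^esub> ?F i = Ident D (Fo X Y)" "?F q \<cdot>\<^bsub>D\<^esub> ?F j = Ident D (Fo X Y')"
    "?F q \<cdot>\<^bsub>D\<^esub> ?F i = Zero D (Fo X Y) (Fo X Y')" "?F p \<cdot>\<^bsub>D\<^esub> ?F j = Zero D (Fo X Y') (Fo X Y)"
    "(?F i \<cdot>\<^bsub>D\<^esub> ?F p) \<boxplus>\<^bsub>D\<^esub> (?F j \<cdot>\<^bsub>D\<^esub> ?F q) = Ident D (Fo X S)"
    using comp obj hom eq mor_ident X mor_zero_right[OF X X _ _ id] by auto
  moreover have "?F i \<in> Hom D (Fo X Y) (Fo X S)" "?F j \<in> Hom D (Fo X Y') (Fo X S)"
    "?F p \<in> Hom D (Fo X S) (Fo X Y)" "?F q \<in> Hom D (Fo X S) (Fo X Y')"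
    using mor_closed obj hom X id by auto
  ultimately show ?thesis
    unfolding direct_sum_def using obj X obj_closed by blast
qed

end

locale additive_monoidal_category = monoidal_category C + additive_category C +
    tensor: additive_bifunctor C C C "TObj C" "TMor C"
  for C :: "('o, 'm, 'z) monoidal_data_scheme" (structure)
begin

lemma tensor_iso_class:
  assumes "X \<in> Obj C" "Y \<in> Obj C"
  shows "tensor_iso_class C (iso_class C X) (iso_class C Y) = iso_class C (X \<otimes>\<^sub>o Y)"
proof -
  have "iso_class C (X' \<otimes>\<^sub>o Y') = iso_class C (X \<otimes>\<^sub>o Y)"
    if "X' \<in> iso_class C X" "Y' \<in> iso_class C Y" for X' Y'
  proof -
    have XY: "isomorphic C X X'" "isomorphic C Y Y'" using that by (auto simp: iso_class_def)
    then have "isomorphic C (X' \<otimes>\<^sub>o Y') (X \<otimes>\<^sub>o Y)"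
      by (intro isomorphic_sym[OF tensor.isomorphic_tensor])
    then show ?thesis
      by (subst iso_class_eq_iff) (auto simp: isomorphic_def)
  qed
  then show ?thesis
    unfolding tensor_iso_class_def using iso_class_self assms by blast
qed

lemma presentation_green: "presentation (iso_classes C) (green_rels C)"
proof
  fix r assume "r \<in> green_rels C"
  then obtain X Y S where r: "r = frag_of (iso_class C X) + frag_of (iso_class C Y) - frag_of (iso_class C S)"
    and "direct_sum C S X Y" unfolding green_rels_def by blast
  then have "X \<in> Obj C" "Y \<in> Obj C" "S \<in> Obj C" by (auto simp: direct_sum_def)
  then show "Poly_Mapping.keys r \<subseteq> iso_classes C"
    unfolding r by (intro keys_diff_subset keys_add_subset) (simp_all add: iso_classI)
qed

lemma iso_mor_iso_class:
  "\<lbrakk>X \<in> Obj C; Y \<in> Obj C; iso_mor C f X Y\<rbrakk> \<Longrightarrow> iso_class C X = iso_class C Y"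
  by (subst iso_class_eq_iff) (auto simp: isomorphic_def)

text \<open>
  The structural isomorphisms of the monoidal category become equalities of isomorphism classes, which
  gives the monoid laws. The relations are stable under multiplication by \<open>[Z]\<close> because tensoring a
  direct sum with \<open>Z\<close> gives a direct sum.
\<close>

lemma ring_presentation_green:
  "ring_presentation (iso_classes C) (green_rels C) (tensor_iso_class C) (iso_class C (TUnit C))"
proof (intro ring_presentation.intro presentation_green ring_presentation_axioms.intro)
  fix U V W assume "U \<in> iso_classes C" "V \<in> iso_classes C" "W \<in> iso_classes C"
  then obtain X Y Z where X: "X \<in> Obj C" "Y \<in> Obj C" "Z \<in> Obj C"
    "U = iso_class C X" "V = iso_class C Y" "W = iso_class C Z"
    by (elim iso_classesE)
  then show "tensor_iso_class C (tensor_iso_class C U V) W = tensor_iso_class C U (tensor_iso_class C V W)"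
    using iso_mor_iso_class[OF _ _ assoc_iso[of X Y Z]]
    by (simp add: tensor_iso_class tensor.obj_closed)
next
  fix U r assume "U \<in> iso_classes C" and r: "r \<in> green_rels C"
  then obtain Z where Z: "Z \<in> Obj C" "U = iso_class C Z" by (elim iso_classesE)
  obtain X Y S where r: "r = frag_of (iso_class C X) + frag_of (iso_class C Y) - frag_of (iso_class C S)"
    and S: "direct_sum C S X Y" using r unfolding green_rels_def by blast
  have obj: "X \<in> Obj C" "Y \<in> Obj C" "S \<in> Obj C" using S by (auto simp: direct_sum_def)
  have "frag_extend (\<lambda>V. frag_of (tensor_iso_class C U V)) r \<in> green_rels C"
    using tensor.direct_sum_tensor_left[OF S Z(1)]
    by (auto simp: r Z obj frag_extend_diff frag_extend_add tensor_iso_class green_rels_def)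
  then show "frag_extend (\<lambda>V. frag_of (tensor_iso_class C U V)) r \<in> relation_span (iso_classes C) (green_rels C)"
    by (rule generate.incl)
  have "frag_extend (\<lambda>V. frag_of (tensor_iso_class C V U)) r \<in> green_rels C"
    using tensor.direct_sum_tensor_right[OF S Z(1)]
    by (auto simp: r Z obj frag_extend_diff frag_extend_add tensor_iso_class green_rels_def)
  then show "frag_extend (\<lambda>V. frag_of (tensor_iso_class C V U)) r \<in> relation_span (iso_classes C) (green_rels C)"
    by (rule generate.incl)
next
  fix U assume "U \<in> iso_classes C"
  then obtain X where X: "X \<in> Obj C" "U = iso_class C X" by (elim iso_classesE)
  show "tensor_iso_class C (iso_class C (TUnit C)) U = U" "tensor_iso_class C U (iso_class C (TUnit C)) = U"
    using iso_mor_iso_class[OF _ _ lunit_iso[OF X(1)]] iso_mor_iso_class[OF _ _ runit_iso[OF X(1)]]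
    by (simp_all add: X tensor_iso_class tensor.obj_closed unit_obj)
next
  fix U V assume "U \<in> iso_classes C" "V \<in> iso_classes C"
  then show "tensor_iso_class C U V \<in> iso_classes C"
    by (elim iso_classesE) (simp add: tensor_iso_class tensor.obj_closed iso_classI)
qed (simp add: unit_obj iso_classI)

theorem ring_green_ring: "ring (green_ring C)"
  unfolding green_ring_def Let_def
  using ring_presentation.ring_presented_group[OF ring_presentation_green, where m = "()"] by simp

section \<open>The split Grothendieck category of a monoidal category\<close>

text \<open>
  An object isomorphic to a direct sum has the same class as that direct sum, so the split relations
  are exactly the negatives of the Green ring relations.
\<close>

lemma relation_span_split_rels:
  "relation_span (iso_classes C) (split_rels C) = relation_span (iso_classes C) (green_rels C)"
proof -
  have split_eq: "split_rels C = uminus ` green_rels C"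
  proof
    show "split_rels C \<subseteq> uminus ` green_rels C"
    proof
      fix r assume "r \<in> split_rels C"
      then obtain X Y Z S where "r = frag_of (iso_class C Y) - frag_of (iso_class C X) - frag_of (iso_class C Z)"
        "direct_sum C S X Z" "isomorphic C Y S" unfolding split_rels_def by blast
      moreover from this have "iso_class C Y = iso_class C S"
        by (subst iso_class_eq_iff) (auto simp: isomorphic_def)
      ultimately have "r = - (frag_of (iso_class C X) + frag_of (iso_class C Z) - frag_of (iso_class C S))"
        "direct_sum C S X Z" by simp_all
      then show "r \<in> uminus ` green_rels C" unfolding green_rels_def by blast
    qed
    show "uminus ` green_rels C \<subseteq> split_rels C"
    proof
      fix r assume "r \<in> uminus ` green_rels C"
      then obtain X Z S where r: "r = - (frag_of (iso_class C X) + frag_of (iso_class C Z) - frag_of (iso_class C S))"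
        and S: "direct_sum C S X Z" unfolding green_rels_def by blast
      have "isomorphic C S S" using S by (intro isomorphic_refl) (simp add: direct_sum_def)
      moreover have "r = frag_of (iso_class C S) - frag_of (iso_class C X) - frag_of (iso_class C Z)"
        by (simp add: r)
      ultimately show "r \<in> split_rels C" using S unfolding split_rels_def by blast
    qed
  qed
  interpret G: presentation "iso_classes C" "green_rels C" by (rule presentation_green)
  interpret S: presentation "iso_classes C" "split_rels C"
    unfolding split_eq by standard (elim imageE, simp add: G.keys_rel)
  have "n \<in> relation_span (iso_classes C) (green_rels C)"
    if "n \<in> relation_span (iso_classes C) (split_rels C)" for n
    using that
  proof (induction n rule: S.relation_span_induct)
    case (rel r) then show ?case
      using G.minus_relation_span generate.incl by (fastforce simp: split_eq)
  qed (simp_all add: G.zero_relation_span G.diff_relation_span)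
  moreover have "n \<in> relation_span (iso_classes C) (split_rels C)"
    if "n \<in> relation_span (iso_classes C) (green_rels C)" for n
    using that
  proof (induction n rule: G.relation_span_induct)
    case (rel r)
    then have "- r \<in> relation_span (iso_classes C) (split_rels C)"
      by (intro generate.incl) (simp add: split_eq)
    then show ?case using S.minus_relation_span by fastforce
  qed (simp_all add: S.zero_relation_span S.diff_relation_span)
  ultimately show ?thesis by blast
qed

end

text \<open>
  The hom-category of the one-object 2-category is the monoidal category with the monoidal fields of
  its record removed; every notion that refers only to the remaining fields is unchanged.
\<close>

lemma truncate_simps:
  "Obj (preadd_data.truncate C) = Obj C" "Hom (preadd_data.truncate C) = Hom C"
  "Comp (preadd_data.truncate C) = Comp C" "Ident (preadd_data.truncate C) = Ident C"
  "Add (preadd_data.truncate C) = Add C" "Zero (preadd_data.truncate C) = Zero C"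
  by (simp_all add: preadd_data.truncate_def)

lemma iso_mor_truncate: "iso_mor (preadd_data.truncate C) = iso_mor C"
  by (simp add: iso_mor_def fun_eq_iff truncate_simps)

lemma isomorphic_truncate: "isomorphic (preadd_data.truncate C) = isomorphic C"
  by (simp add: isomorphic_def fun_eq_iff truncate_simps iso_mor_truncate)

lemma iso_class_truncate: "iso_class (preadd_data.truncate C) = iso_class C"
  by (simp add: iso_class_def fun_eq_iff isomorphic_truncate)

lemma iso_classes_truncate: "iso_classes (preadd_data.truncate C) = iso_classes C"
  by (simp add: iso_classes_def iso_class_truncate truncate_simps)

lemma direct_sum_truncate: "direct_sum (preadd_data.truncate C) = direct_sum C"
  by (simp add: direct_sum_def fun_eq_iff truncate_simps)

lemma split_rels_truncate: "split_rels (preadd_data.truncate C) = split_rels C"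
  by (simp add: split_rels_def iso_class_truncate direct_sum_truncate isomorphic_truncate)

lemma hom_group_truncate: "hom_group (preadd_data.truncate C) = hom_group C"
  by (simp add: hom_group_def fun_eq_iff truncate_simps)

lemma category_truncate: "category (preadd_data.truncate C) = category C"
  by (simp add: category_def truncate_simps)

lemma preadditive_category_truncate:
  "preadditive_category (preadd_data.truncate C) = preadditive_category C"
  by (simp add: preadditive_category_def preadditive_category_axioms_def category_truncate
      truncate_simps hom_group_truncate)

lemma additive_category_truncate: "additive_category (preadd_data.truncate C) = additive_category C"
  by (simp add: additive_category_def additive_category_axioms_def preadditive_category_truncate
      truncate_simps direct_sum_truncate zero_object_def)

lemma additive_bifunctor_truncate:
  "additive_bifunctor (preadd_data.truncate A) (preadd_data.truncate B) (preadd_data.truncate D)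
    = additive_bifunctor A B D"
  by (simp add: additive_bifunctor_def additive_bifunctor_axioms_def bifunctor_def bifunctor_axioms_def
      preadditive_category_truncate category_truncate truncate_simps fun_eq_iff)

lemma one_object_2category_simps:
  "Cells (one_object_2category C) = {()}"
  "HomCat (one_object_2category C) i j = preadd_data.truncate C"
  "HObj (one_object_2category C) i j k = TObj C"
  "HMor (one_object_2category C) i j k = TMor C"
  "HUnit (one_object_2category C) i = TUnit C"
  "HAssoc (one_object_2category C) i j k l = Assoc C"
  "HLUnit (one_object_2category C) i j = LUnit C"
  "HRUnit (one_object_2category C) i j = RUnit C"
  by (simp_all add: one_object_2category_def)

text \<open>
  With a single object, the axioms of an additive 2-category are those of a monoidal category with an
  additive tensor product.
\<close>

lemma additive_2category_one_object:
  fixes C :: "('o, 'm) monoidal_data"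
  assumes "additive_monoidal_category C"
  shows "additive_2category (one_object_2category C)"
proof -
  interpret additive_monoidal_category C by fact
  show ?thesis
    by (intro additive_2category.intro;
      simp only: one_object_2category_simps additive_category_truncate additive_bifunctor_truncate
        truncate_simps iso_mor_truncate)
      (rule additive_category_axioms tensor.additive_bifunctor_axioms unit_obj assoc_iso assoc_natural
        lunit_iso lunit_natural runit_iso runit_natural pentagon triangle; assumption)+
qed

text \<open>
  Both rings are the same presented group with the same multiplication, since horizontal composition
  is the tensor product; the map only adds the tags of source and target. The second part is needed
  because ring homomorphisms are not required to respect the zero field of the record.
\<close>

lemma ring_iso_green_End_split:
  fixes C :: "('o, 'm) monoidal_data"
  assumes "additive_monoidal_category C"
  defines "P \<equiv> split_grothendieck_category (one_object_2category C)"
  shows "(\<lambda>U. ((), (), U)) \<in> ring_iso (green_ring C) (End_ring P ())"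
    and "\<zero>\<^bsub>End_ring P ()\<^esub> = ((), (), \<zero>\<^bsub>green_ring C\<^esub>)"
proof -
  interpret additive_monoidal_category C by fact
  let ?T = "preadd_data.truncate C"
  have cls: "presented_class (iso_classes ?T) (split_rels ?T) = presented_class (iso_classes C) (green_rels C)"
    by (simp add: presented_class_def fun_eq_iff iso_classes_truncate split_rels_truncate relation_span_split_rels)
  have grp: "split_grothendieck_group ?T = presented_group (iso_classes C) (green_rels C)"
    by (simp add: split_grothendieck_group_def presented_group_def iso_classes_truncate split_rels_truncate
        relation_span_split_rels)
  have bil: "presented_bilinear (iso_classes ?T) (split_rels ?T) \<beta>
    = presented_bilinear (iso_classes C) (green_rels C) \<beta>" for \<beta> :: "'o set \<Rightarrow> 'o set \<Rightarrow> ('o set \<Rightarrow>\<^sub>0 int)"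
    by (simp add: presented_bilinear_def fun_eq_iff cls)
  have hcomp: "hcomp_iso_class (one_object_2category C) i j k = tensor_iso_class C" for i j k
    by (simp add: hcomp_iso_class_def tensor_iso_class_def fun_eq_iff one_object_2category_simps
        iso_class_truncate)
  show "(\<lambda>U. ((), (), U)) \<in> ring_iso (green_ring C) (End_ring P ())"
    by (rule ring_iso_memI)
      (auto simp: P_def split_grothendieck_category_def End_ring_def green_ring_def Let_def
        one_object_2category_simps cls grp bil hcomp iso_class_truncate bij_betw_def inj_on_def)
  show "\<zero>\<^bsub>End_ring P ()\<^esub> = ((), (), \<zero>\<^bsub>green_ring C\<^esub>)"
    by (simp add: P_def split_grothendieck_category_def End_ring_def green_ring_def Let_def
        one_object_2category_simps grp)
qed

theorem theorem2p2:
  fixes K :: "('k, 'e) ring_scheme"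
    and C :: "('o, 'm) monoidal_data"
  assumes "algebraically_closed K"
    and "monoidal_category C"
    and "krull_schmidt_category C"
    and "additive_bifunctor C C C (TObj C) (TMor C)"
  shows "decategorification K (one_object_category (K_green_ring K C)) (one_object_2category C) \<and>
    categorification K (one_object_2category C) (one_object_category (K_green_ring K C)) \<and>
    linear_isomorphic K
      (scalar_extension_category K (split_grothendieck_category (one_object_2category C)))
      (one_object_category (K_green_ring K C))"
proof -
  let ?P = "split_grothendieck_category (one_object_2category C)"
  let ?\<tau> = "\<lambda>U. ((), (), U)"
  have C: "additive_monoidal_category C"
    using assms(2-4) by (intro additive_monoidal_category.intro krull_schmidt_category.axioms)
  have K: "cring K"
    using assms(1) by (intro domain.axioms field.axioms algebraically_closed.axioms)
  have R: "ring (green_ring C)"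
    using C by (rule additive_monoidal_category.ring_green_ring)
  have \<tau>: "?\<tau> \<in> ring_iso (green_ring C) (End_ring ?P ())"
    using C by (rule ring_iso_green_End_split)
  have P: "ring (End_ring ?P ())"
    using ring.ring_iso_imp_img_ring[OF R \<tau>, folded ring_iso_green_End_split(2)[OF C]]
    by (simp add: End_ring_def)
  have h: "inv_into (carrier (green_ring C)) ?\<tau> \<in> ring_iso (End_ring ?P ()) (green_ring C)"
    using R \<tau> by (rule ring_iso_set_sym)
  have obj: "Obj ?P = {()}"
    by (simp add: split_grothendieck_category_def one_object_2category_simps)
  have "linear_isomorphic K (scalar_extension_category K ?P) (one_object_category (K_green_ring K C))"
    unfolding K_green_ring_def
    by (rule one_object_presentation.linear_isomorphic_one_object
        [OF one_object_presentation_scalar_extension_category[OF K R P obj h]])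
  moreover have "linear_category K (one_object_category (K_green_ring K C))"
    unfolding K_green_ring_def
    by (intro unital_algebra.linear_category_one_object scalar_extension.unital_algebra_ext
        scalar_extension.intro K R)
  ultimately show ?thesis
    using additive_2category_one_object[OF C] by (simp add: decategorification_def categorification_def)
qed

end
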